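(* Let $M:\mathbb{R}^n\to\mathbb{R}$ be the network \[M(x) = w^T \phi(\mathbf{W}_1 \phi(\mathbf{W}_{2} \phi( \dots \mathbf{W}_d \phi(\mathbf{A} x))\dots)),\] where $\mathbf{A}\in\mathbb{R}^{k\times n}$ has rank $k$ (with $k<n$), $\mathbf{W}_i\in\mathbb{R}^{k_i\times k_{i+1}}$ for $i\in[d]$ with $k_{d+1}=k$, $w\in\mathbb{R}^{k_1}$, and $\phi$ is the ReLU applied coordinatewise. Let $\gamma>0$ and suppose $M$ satisfies: (Assumption 1) for every sign pattern $S\in\{0,1\}^k$, $\Pr_{g\sim\mathcal{N}(0,\mathbb{I}_n)}[\operatorname{sign}(\phi(\mathbf{A}g))=S]\ge \gamma/2^k$; (Assumption 2) for any nonempty $S_1\subseteq[k_1],\dots,S_d\subseteq[k_d]$, the vector $w^T\prod_{i=1}^d(\mathbf{W}_i)_{S_i}\in\mathbb{R}^k$ is entrywise non-zero, and moreover $\Pr_{g\sim\mathcal{N}(0,\mathbb{I}_n)}[M(g)=0]\le \gamma/8$. Then for every $\delta\in(0,1)$, Algorithm 1 (described in the context) makes $O(kn\log(k/\delta)/\gamma)$ queries to $M$ and returns, in $\mathrm{poly}(n,k,1/\gamma,\log(1/\delta))$ time, a subspace $V\subseteq\operatorname{span}(\mathbf{A})$ (the row span of $\mathbf{A}$) of dimension at least $k/2$, with probability at least $1-\delta$.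
   Context: The algorithm has only oracle (black-box) access to the values $M(x)$ for query points $x\in\mathbb{R}^n$. For $x\in\mathbb{R}^m$, $\operatorname{sign}(x)\in\{0,1\}^m$ denotes the indicator vector of the non-zero coordinates of $x$ ($\operatorname{sign}(x)_i=1$ iff $x_i\neq 0$). For a matrix $\mathbf{W}$ and a set $S$ of row indices, $(\mathbf{W})_S$ is the matrix obtained from $\mathbf{W}$ by setting all rows not in $S$ to $0$. Algorithm 1: set $r=O(k\log(k/\delta)/\gamma)$; for $i=1,\dots,r$ draw independent $g^i\sim\mathcal{N}(0,\mathbb{I}_n)$ and compute the gradient $z^i=\nabla M(g^i)$ using $O(n)$ queries to $M$ (via finite differences/perturbations around $g^i$); return $\operatorname{Span}(z^1,\dots,z^r)$. *)

theory Defs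
  imports
    "HOL-Probability.Probability"
    "HOL-Library.Monad_Syntax"
    "Jordan_Normal_Form.DL_Rank"
begin

no_notation Finite_Cartesian_Product.vec_nth (infixl \<open>$\<close> 90)


section \<open>ReLU networks\<close>

definition relu :: "real Matrix.vec \<Rightarrow> real Matrix.vec" where
  "relu x = map_vec (\<lambda>t. max 0 t) x"

definition network ::
    "real Matrix.vec \<Rightarrow> real mat list \<Rightarrow> real mat \<Rightarrow> real Matrix.vec \<Rightarrow> real" where
  "network w Ws A x = w \<bullet> foldr (\<lambda>W y. relu (W *\<^sub>v y)) Ws (relu (A *\<^sub>v x))"

text \<open>The list \<open>ks\<close> is \<open>[k\<^sub>1, \<dots>, k\<^sub>d]\<close>; appending \<open>k\<close> supplies \<open>k\<^sub>d\<^sub>+\<^sub>1 = k\<close>.  Lists are indexed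
  from 0, so \<open>Ws ! i\<close> is the matrix with subscript \<open>i + 1\<close>.\<close>

definition network_shape ::
    "nat \<Rightarrow> nat \<Rightarrow> nat list \<Rightarrow> real Matrix.vec \<Rightarrow> real mat list \<Rightarrow> real mat \<Rightarrow> bool" where
  "network_shape n k ks w Ws A \<longleftrightarrow>
     A \<in> carrier_mat k n \<and>
     length Ws = length ks \<and>
     (\<forall>i<length ks. Ws ! i \<in> carrier_mat ((ks @ [k]) ! i) ((ks @ [k]) ! Suc i)) \<and>
     w \<in> carrier_vec ((ks @ [k]) ! 0)"


section \<open>Gaussian vectors and the two assumptions\<close>

definition std_gaussian :: "nat set \<Rightarrow> (nat \<Rightarrow> real) measure" where
  "std_gaussian I = PiM I (\<lambda>_. density lborel std_normal_density)"

definition gauss_prob :: "nat \<Rightarrow> (real Matrix.vec \<Rightarrow> bool) \<Rightarrow> real" where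
  "gauss_prob n P =
     measure (std_gaussian {..<n}) {g \<in> space (std_gaussian {..<n}). P (Matrix.vec n g)}"

definition sign_pattern :: "real Matrix.vec \<Rightarrow> nat Matrix.vec" where
  "sign_pattern x = map_vec (\<lambda>t. if t \<noteq> 0 then 1 else 0) x"

definition mask_rows :: "nat set \<Rightarrow> real mat \<Rightarrow> real mat" where
  "mask_rows S W =
     Matrix.mat (dim_row W) (dim_col W) (\<lambda>(i, j). if i \<in> S then W $$ (i, j) else 0)"

definition assumption1 :: "nat \<Rightarrow> nat \<Rightarrow> real \<Rightarrow> real mat \<Rightarrow> bool" where
  "assumption1 n k \<gamma> A \<longleftrightarrow>
     (\<forall>S \<in> carrier_vec k. (\<forall>i<k. S $ i \<in> {0, 1}) \<longrightarrow>
        gauss_prob n (\<lambda>g. sign_pattern (relu (A *\<^sub>v g)) = S) \<ge> \<gamma> / 2 ^ k)"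

definition assumption2 ::
    "nat \<Rightarrow> nat \<Rightarrow> nat list \<Rightarrow> real \<Rightarrow> real Matrix.vec \<Rightarrow> real mat list \<Rightarrow> real mat \<Rightarrow> bool" where
  "assumption2 n k ks \<gamma> w Ws A \<longleftrightarrow>
     (\<forall>Ss. length Ss = length ks \<and> (\<forall>i<length ks. Ss ! i \<noteq> {} \<and> Ss ! i \<subseteq> {..<ks ! i}) \<longrightarrow>
        (\<forall>j<k. (mat_of_row w * foldr (*) (map2 mask_rows Ss Ws) (1\<^sub>m k)) $$ (0, j) \<noteq> 0)) \<and>
     gauss_prob n (\<lambda>g. network w Ws A g = 0) \<le> \<gamma> / 8"


section \<open>Randomised real-RAM programs with oracle access\<close>

text \<open>A program can learn about \<open>M\<close> only through \<open>Query\<close>.  Its cost is counted in the unit-cost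
  real-RAM model: \<open>Step\<close> is one elementary operation, and a query pays for writing down the
  query point in addition to the call itself.  \<open>Gauss\<close> draws a fresh standard normal number; the
  draws are read off one by one from a tape \<open>\<omega>\<close> of independent standard normals.\<close>

datatype 'a prog =
    Return 'a
  | Step "'a prog"
  | Query "real list" "real \<Rightarrow> 'a prog"
  | Gauss "real \<Rightarrow> 'a prog"

primrec bind_prog :: "'a prog \<Rightarrow> ('a \<Rightarrow> 'b prog) \<Rightarrow> 'b prog" where
  "bind_prog (Return a) f = f a"
| "bind_prog (Step p) f = Step (bind_prog p f)"
| "bind_prog (Query x c) f = Query x (\<lambda>y. bind_prog (c y) f)"
| "bind_prog (Gauss c) f = Gauss (\<lambda>y. bind_prog (c y) f)"

adhoc_overloading Monad_Syntax.bind \<rightleftharpoons> bind_prog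

primrec outcome :: "'a prog \<Rightarrow> (real Matrix.vec \<Rightarrow> real) \<Rightarrow> (nat \<Rightarrow> real) \<Rightarrow> 'a" where
  "outcome (Return a) M \<omega> = a"
| "outcome (Step p) M \<omega> = outcome p M \<omega>"
| "outcome (Query x c) M \<omega> = outcome (c (M (vec_of_list x))) M \<omega>"
| "outcome (Gauss c) M \<omega> = outcome (c (\<omega> 0)) M (\<lambda>i. \<omega> (Suc i))"

primrec queries :: "'a prog \<Rightarrow> (real Matrix.vec \<Rightarrow> real) \<Rightarrow> (nat \<Rightarrow> real) \<Rightarrow> nat" where
  "queries (Return a) M \<omega> = 0"
| "queries (Step p) M \<omega> = queries p M \<omega>"
| "queries (Query x c) M \<omega> = 1 + queries (c (M (vec_of_list x))) M \<omega>"
| "queries (Gauss c) M \<omega> = queries (c (\<omega> 0)) M (\<lambda>i. \<omega> (Suc i))"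

primrec run_time :: "'a prog \<Rightarrow> (real Matrix.vec \<Rightarrow> real) \<Rightarrow> (nat \<Rightarrow> real) \<Rightarrow> nat" where
  "run_time (Return a) M \<omega> = 1"
| "run_time (Step p) M \<omega> = 1 + run_time p M \<omega>"
| "run_time (Query x c) M \<omega> = 1 + length x + run_time (c (M (vec_of_list x))) M \<omega>"
| "run_time (Gauss c) M \<omega> = 1 + run_time (c (\<omega> 0)) M (\<lambda>i. \<omega> (Suc i))"

text \<open>Convention: the argument of \<open>elem\<close> is a single operation (arithmetic, \<open>ln\<close>, ceiling, or
  list construction) applied to values that are already available.\<close>

definition elem :: "'a \<Rightarrow> 'a prog" where
  "elem a = Step (Return a)"

primrec for_each :: "'a list \<Rightarrow> ('a \<Rightarrow> 'b prog) \<Rightarrow> 'b list prog" where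
  "for_each [] f = Return []"
| "for_each (x # xs) f = do { y \<leftarrow> f x; ys \<leftarrow> for_each xs f; elem (y # ys) }"


section \<open>The algorithm\<close>

text \<open>\<open>perturb \<epsilon> x j\<close> computes \<open>x + \<epsilon> e\<^sub>j\<close>.\<close>

fun perturb :: "real \<Rightarrow> real list \<Rightarrow> nat \<Rightarrow> real list prog" where
  "perturb \<epsilon> [] j = Return []"
| "perturb \<epsilon> (x # xs) 0 = do { y \<leftarrow> elem (x + \<epsilon>); elem (y # xs) }"
| "perturb \<epsilon> (x # xs) (Suc j) = do { ys \<leftarrow> perturb \<epsilon> xs j; elem (x # ys) }"

definition finite_differences :: "real \<Rightarrow> nat \<Rightarrow> real list \<Rightarrow> real list prog" where
  "finite_differences \<epsilon> n g = do {
     y0 \<leftarrow> Query g Return;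
     for_each [0..<n] (\<lambda>j. do {
       g' \<leftarrow> perturb \<epsilon> g j;
       y \<leftarrow> Query g' Return;
       s \<leftarrow> elem (y - y0);
       elem (s / \<epsilon>)
     })
   }"

definition num_rounds :: "real \<Rightarrow> nat \<Rightarrow> real \<Rightarrow> real \<Rightarrow> nat prog" where
  "num_rounds c k \<gamma> \<delta> = do {
     a \<leftarrow> elem (real k / \<delta>);
     a \<leftarrow> elem (ln a);
     a \<leftarrow> elem (real k * a);
     a \<leftarrow> elem (c * a);
     a \<leftarrow> elem (a / \<gamma>);
     elem (nat \<lceil>a\<rceil>)
   }"

text \<open>\<open>c\<close> is the constant hidden in \<open>r = O(k log (k / \<delta>) / \<gamma>)\<close>, and \<open>\<epsilon>\<close> is the step of the finite
  differences.  Since \<open>M\<close> is linear on finitely many cones, the difference quotients agree with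
  the gradient once \<open>\<epsilon>\<close> is small compared to the distance of the sample point from the
  boundaries of these cones; \<open>\<epsilon>\<close> is a fixed parameter, chosen without looking at the weights.
  The subspace is returned through its spanning list \<open>z\<^sup>1, \<dots>, z\<^sup>r\<close>; every \<open>z\<^sup>i\<close> is
  paired with the sample point \<open>g\<^sup>i\<close> so that it can be compared with the gradient there.\<close>

definition span_recovery ::
    "real \<Rightarrow> real \<Rightarrow> nat \<Rightarrow> nat \<Rightarrow> real \<Rightarrow> real \<Rightarrow> (real list \<times> real list) list prog" where
  "span_recovery c \<epsilon> n k \<gamma> \<delta> = do {
     r \<leftarrow> num_rounds c k \<gamma> \<delta>;
     for_each [0..<r] (\<lambda>_. do {
       g \<leftarrow> for_each [0..<n] (\<lambda>_. Gauss Return);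
       z \<leftarrow> finite_differences \<epsilon> n g;
       Return (g, z)
     })
   }"

definition returned_subspace :: "nat \<Rightarrow> (real list \<times> real list) list \<Rightarrow> real Matrix.vec set" where
  "returned_subspace n gzs =
     LinearCombinations.module.span class_ring (module_vec TYPE(real) n)
       ((\<lambda>(g, z). vec_of_list z) ` set gzs)"

definition subspace_dim :: "nat \<Rightarrow> real Matrix.vec set \<Rightarrow> nat" where
  "subspace_dim n V =
     vectorspace.dim class_ring ((module_vec TYPE(real) n)\<lparr>carrier := V\<rparr>)"

definition is_gradient ::
    "nat \<Rightarrow> (real Matrix.vec \<Rightarrow> real) \<Rightarrow> real Matrix.vec \<Rightarrow> real Matrix.vec \<Rightarrow> bool" where
  "is_gradient n F x z \<longleftrightarrow>
     x \<in> carrier_vec n \<and> z \<in> carrier_vec n \<and>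
     (\<forall>j<n. ((\<lambda>t. F (x + t \<cdot>\<^sub>v unit_vec n j)) has_real_derivative z $ j) (at 0))"

text \<open>The event that all the \<open>z\<^sup>i\<close> are exact gradients and the returned subspace is as required.\<close>

definition success ::
    "nat \<Rightarrow> nat \<Rightarrow> real mat \<Rightarrow> (real Matrix.vec \<Rightarrow> real) \<Rightarrow> (real list \<times> real list) list \<Rightarrow> bool" where
  "success n k A M gzs \<longleftrightarrow>
     (\<forall>(g, z) \<in> set gzs. is_gradient n M (vec_of_list g) (vec_of_list z)) \<and>
     returned_subspace n gzs \<subseteq> vec_space.row_space n A \<and>
     real (subspace_dim n (returned_subspace n gzs)) \<ge> real k / 2"

end

theory Submission
  imports Defs
begin

text \<open>A ReLU network is linear on each of finitely many cones, which are cut out by the vanishing of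
  pre-activations.  Their number depends only on the layer sizes, and a Gaussian vector is within
  \<open>\<epsilon>\<close> of a fixed hyperplane with probability \<open>O(\<epsilon>)\<close>; so for small \<open>\<epsilon>\<close>, chosen uniformly in the
  weights, all difference quotients are exact gradients up to a negligible probability.

  At a point \<open>g\<close> with \<open>M(g) \<noteq> 0\<close> the gradient is \<open>A\<^sup>T c\<close>, where by Assumption 2 the support of \<open>c\<close> is
  exactly the sign pattern of \<open>A g\<close>.  A subspace of dimension less than \<open>k / 2\<close> contains \<open>A\<^sup>T c\<close> for vectors
  \<open>c\<close> of at most \<open>2\<^bsup>k - 1\<^esup>\<close> different supports, so by Assumption 1 a fresh gradient leaves it with
  probability at least \<open>\<gamma> / 2 - \<gamma> / 8\<close>.  A potential argument over the rounds finishes the proof.\<close>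


section \<open>Semantics and cost of the programs\<close>

text \<open>The quantifier order shapes the proof: \<epsilon>0 may depend on the layer sizes,
  \<gamma> and \<delta>, but not on the weights. Hence hyperplanes are counted over all choices of
  row masks, realised or not, and closeness of x to the hyperplane with normal l is measured by |l .
  x| \<le> \<epsilon> |l_j|, a condition that does not change when l is rescaled. The success event
  needs its own measurability proof: \<open>measure\<close> is 0 on non-measurable sets, so
  exhibiting a measurable subset of the event would not bound its probability from below. Near the
  hyperplanes the difference quotients can take infinitely many values, so the derivative, row-space
  and dimension conditions are all rewritten as countable combinations of measurable ones. The
  failure probability \<delta> is split into \<delta>^2 for a span that stays too small, which
  dictates c = 16, and \<delta> - \<delta>^2 for inexact quotients, which dictates
  \<epsilon>0.\<close>

primrec draws :: "'a prog \<Rightarrow> (real Matrix.vec \<Rightarrow> real) \<Rightarrow> (nat \<Rightarrow> real) \<Rightarrow> nat" where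
  "draws (Return a) M \<omega> = 0"
| "draws (Step p) M \<omega> = draws p M \<omega>"
| "draws (Query x c) M \<omega> = draws (c (M (vec_of_list x))) M \<omega>"
| "draws (Gauss c) M \<omega> = 1 + draws (c (\<omega> 0)) M (\<lambda>i. \<omega> (Suc i))"

text \<open>The tape is read sequentially, so after \<open>p\<close> the continuation sees it
  shifted by \<open>draws p M \<omega>\<close>; this is the reason for counting draws.\<close>

lemma outcome_bind:
  "outcome (bind_prog p f) M \<omega> = outcome (f (outcome p M \<omega>)) M (\<lambda>i. \<omega> (i + draws p M \<omega>))"
  by (induction p arbitrary: \<omega>) auto

lemma draws_bind:
  "draws (bind_prog p f) M \<omega> =
     draws p M \<omega> + draws (f (outcome p M \<omega>)) M (\<lambda>i. \<omega> (i + draws p M \<omega>))"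
  by (induction p arbitrary: \<omega>) auto

lemma queries_bind:
  "queries (bind_prog p f) M \<omega> =
     queries p M \<omega> + queries (f (outcome p M \<omega>)) M (\<lambda>i. \<omega> (i + draws p M \<omega>))"
  by (induction p arbitrary: \<omega>) auto

text \<open>The \<open>+ 1\<close> compensates for the unit cost of the final \<open>Return\<close>
  of \<open>p\<close>, which \<open>bind_prog\<close> replaces by the continuation.\<close>

lemma run_time_bind:
  "run_time (bind_prog p f) M \<omega> + 1 =
     run_time p M \<omega> + run_time (f (outcome p M \<omega>)) M (\<lambda>i. \<omega> (i + draws p M \<omega>))"
  by (induction p arbitrary: \<omega>) auto

text \<open>Gives that unit away and asks for a bound on every tape, so that the bounds of nested
  binds simply add up.\<close>

lemma run_time_bind_le:
  assumes "run_time p M \<omega> \<le> a" "\<And>\<omega>'. run_time (f (outcome p M \<omega>)) M \<omega>' \<le> b"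
  shows "run_time (bind_prog p f) M \<omega> \<le> a + b"
  using run_time_bind[of p f M \<omega>] assms(1)
    assms(2)[of "\<lambda>i. \<omega> (i + draws p M \<omega>)"] by linarith

lemma elem_simps [simp]:
  "outcome (elem a) M \<omega> = a" "draws (elem a) M \<omega> = 0" "queries (elem a) M \<omega> = 0"
  "run_time (elem a) M \<omega> = 2"
  by (auto simp: elem_def)

lemma draws_for_each:
  assumes "\<And>x \<omega>. x \<in> set xs \<Longrightarrow> draws (f x) M \<omega> = d"
  shows "draws (for_each xs f) M \<omega> = length xs * d"
  using assms by (induction xs arbitrary: \<omega>) (auto simp: draws_bind)

lemma queries_for_each:
  assumes "\<And>x \<omega>. x \<in> set xs \<Longrightarrow> queries (f x) M \<omega> = q"
  shows "queries (for_each xs f) M \<omega> = length xs * q"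
  using assms by (induction xs arbitrary: \<omega>) (auto simp: queries_bind)

lemma run_time_for_each:
  assumes "\<And>x \<omega>. x \<in> set xs \<Longrightarrow> run_time (f x) M \<omega> \<le> t"
  shows "run_time (for_each xs f) M \<omega> \<le> length xs * (t + 2) + 1"
  using assms
proof (induction xs arbitrary: \<omega>)
  case (Cons x xs)
  have "run_time (for_each (x # xs) f) M \<omega> \<le> t + ((length xs * (t + 2) + 1) + 2)"
    unfolding for_each.simps by (intro run_time_bind_le) (use Cons in auto)
  then show ?case by simp
qed simp

text \<open>When every iteration draws the same number \<open>d\<close> of Gaussians, iteration
  \<open>i\<close> starts at tape position \<open>i * d\<close> whatever happened before; this makes
  the samples of different rounds disjoint segments of the tape.\<close>

lemma outcome_for_each:
  assumes "\<And>x \<omega>. x \<in> set xs \<Longrightarrow> draws (f x) M \<omega> = d"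
  shows "outcome (for_each xs f) M \<omega> =
    map (\<lambda>i. outcome (f (xs ! i)) M (\<lambda>j. \<omega> (j + i * d))) [0..<length xs]"
  using assms
proof (induction xs arbitrary: \<omega>)
  case (Cons x xs)
  have "[0..<length (x # xs)] = 0 # map Suc [0..<length xs]"
    by (simp add: upt_conv_Cons map_Suc_upt del: upt_Suc)
  then show ?case
    using Cons by (simp add: outcome_bind draws_for_each ac_simps del: upt_Suc)
qed simp

section \<open>Perturbations and difference quotients\<close>

lemma draws_perturb [simp]: "draws (perturb \<epsilon> xs j) M \<omega> = 0"
  by (induction \<epsilon> xs j arbitrary: \<omega> rule: perturb.induct) (auto simp: draws_bind)

lemma queries_perturb [simp]: "queries (perturb \<epsilon> xs j) M \<omega> = 0"
  by (induction \<epsilon> xs j arbitrary: \<omega> rule: perturb.induct) (auto simp: queries_bind)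

lemma outcome_perturb [simp]:
  "outcome (perturb \<epsilon> xs j) M \<omega> = (if j < length xs then xs[j := xs ! j + \<epsilon>] else xs)"
  by (induction \<epsilon> xs j arbitrary: \<omega> rule: perturb.induct) (auto simp: outcome_bind)

lemma run_time_perturb: "run_time (perturb \<epsilon> xs j) M \<omega> \<le> length xs + 3"
proof (induction \<epsilon> xs j arbitrary: \<omega> rule: perturb.induct)
  case (3 \<epsilon> x xs j)
  \<comment> \<open>The exact law gives slope 1 in the length; \<open>run_time_bind_le\<close> would
    charge 2 for every entry.\<close>
  show ?case
    using run_time_bind[of "perturb \<epsilon> xs j" "\<lambda>ys. elem (x # ys)" M \<omega>] "3.IH"[of \<omega>]
    unfolding perturb.simps elem_simps list.size by linarith
qed (auto simp: elem_def)

definition quotients ::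
    "real \<Rightarrow> nat \<Rightarrow> (real Matrix.vec \<Rightarrow> real) \<Rightarrow> real Matrix.vec \<Rightarrow> real Matrix.vec" where
  "quotients \<epsilon> n M x = Matrix.vec n (\<lambda>j. (M (x + \<epsilon> \<cdot>\<^sub>v unit_vec n j) - M x) / \<epsilon>)"

lemma vec_of_list_perturb:
  fixes \<epsilon> :: real
  assumes "j < length g"
  shows "vec_of_list (g[j := g ! j + \<epsilon>]) = vec_of_list g + \<epsilon> \<cdot>\<^sub>v unit_vec (length g) j"
  using assms by (intro eq_vecI) (auto simp: vec_of_list_index nth_list_update)

lemma finite_differences_simps:
  assumes "length g = n"
  shows "draws (finite_differences \<epsilon> n g) M \<omega> = 0"
    "queries (finite_differences \<epsilon> n g) M \<omega> = n + 1"
    "vec_of_list (outcome (finite_differences \<epsilon> n g) M \<omega>) = quotients \<epsilon> n M (vec_of_list g)"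
    "run_time (finite_differences \<epsilon> n g) M \<omega> \<le> 2 * n * n + 12 * n + 4"
proof -
  let ?f = "\<lambda>y0 j. do {
       g' \<leftarrow> perturb \<epsilon> g j;
       y \<leftarrow> Query g' Return;
       s \<leftarrow> elem (y - y0);
       elem (s / \<epsilon>)
     }"
  have d: "draws (?f y0 j) M \<omega> = 0" for y0 j \<omega>
    by (simp add: draws_bind)
  have q: "queries (?f y0 j) M \<omega> = 1" for y0 j \<omega>
    by (simp add: queries_bind)
  have o: "outcome (?f y0 j) M \<omega> = (M (vec_of_list g + \<epsilon> \<cdot>\<^sub>v unit_vec n j) - y0) / \<epsilon>"
    if "j < n" for y0 j \<omega>
    using that assms by (simp add: outcome_bind vec_of_list_perturb)
  \<comment> \<open>The summands: the perturbation; the query with its \<open>n\<close> entries, the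
    call and the closing \<open>Return\<close>; a subtraction and a division at cost 2 each.\<close>
  have t: "run_time (?f y0 j) M \<omega> \<le> (n + 3) + ((n + 2) + (2 + 2))" if "j < n" for y0 j \<omega>
    by (intro run_time_bind_le run_time_perturb[of \<epsilon> g, unfolded assms])
      (use assms that in auto)
  show "draws (finite_differences \<epsilon> n g) M \<omega> = 0"
    using draws_for_each[of "[0..<n]" "?f (M (vec_of_list g))" M 0] d
    by (simp add: finite_differences_def draws_bind)
  show "queries (finite_differences \<epsilon> n g) M \<omega> = n + 1"
    using queries_for_each[of "[0..<n]" "?f (M (vec_of_list g))" M 1] q
    by (simp add: finite_differences_def queries_bind)
  have "outcome (finite_differences \<epsilon> n g) M \<omega> =
      map (\<lambda>j. (M (vec_of_list g + \<epsilon> \<cdot>\<^sub>v unit_vec n j) - M (vec_of_list g)) / \<epsilon>) [0..<n]"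
    using outcome_for_each[of "[0..<n]" "?f (M (vec_of_list g))" M 0 \<omega>] d o
    by (simp add: finite_differences_def)
  then show "vec_of_list (outcome (finite_differences \<epsilon> n g) M \<omega>) =
      quotients \<epsilon> n M (vec_of_list g)"
    by (auto simp: quotients_def vec_of_list_index intro!: eq_vecI)
  have "run_time (finite_differences \<epsilon> n g) M \<omega> \<le>
      (n + 2) + (length [0..<n] * ((n + 3) + ((n + 2) + (2 + 2)) + 2) + 1)"
    unfolding finite_differences_def
    by (rule run_time_bind_le, use assms in simp, rule run_time_for_each, rule t) simp
  then show "run_time (finite_differences \<epsilon> n g) M \<omega> \<le> 2 * n * n + 12 * n + 4"
    by (simp add: algebra_simps)
qed

text \<open>The sample point of round \<open>i\<close>: with \<open>n\<close> draws per round and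
  none elsewhere, round \<open>i\<close> owns the tape positions from \<open>i * n\<close> up to
  \<open>i * n + n - 1\<close>.\<close>

definition block :: "nat \<Rightarrow> nat \<Rightarrow> (nat \<Rightarrow> real) \<Rightarrow> real Matrix.vec" where
  "block n i \<omega> = Matrix.vec n (\<lambda>j. \<omega> (j + i * n))"

definition rounds :: "real \<Rightarrow> nat \<Rightarrow> real \<Rightarrow> real \<Rightarrow> nat" where
  "rounds c k \<gamma> \<delta> = nat \<lceil>c * (real k * ln (real k / \<delta>)) / \<gamma>\<rceil>"

text \<open>The last equation is the interface to the probabilistic part, which only sees this
  explicit list of sample points and quotients; \<open>map_prod\<close> passes from lists to
  vectors.\<close>

lemma span_recovery_simps:
  shows "queries (span_recovery c \<epsilon> n k \<gamma> \<delta>) M \<omega> = rounds c k \<gamma> \<delta> * (n + 1)"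
    "run_time (span_recovery c \<epsilon> n k \<gamma> \<delta>) M \<omega> \<le> rounds c k \<gamma> \<delta> * (2 * n * n + 16 * n + 8) + 13"
    "map (map_prod vec_of_list vec_of_list) (outcome (span_recovery c \<epsilon> n k \<gamma> \<delta>) M \<omega>) =
       map (\<lambda>i. (block n i \<omega>, quotients \<epsilon> n M (block n i \<omega>))) [0..<rounds c k \<gamma> \<delta>]"
proof -
  let ?g = "for_each [0..<n] (\<lambda>_. Gauss Return)"
  let ?f = "do {
       g \<leftarrow> ?g;
       z \<leftarrow> finite_differences \<epsilon> n g;
       Return (g, z)
     }"
  have nr: "draws (num_rounds c k \<gamma> \<delta>) M \<omega> = 0" "queries (num_rounds c k \<gamma> \<delta>) M \<omega> = 0"
    "outcome (num_rounds c k \<gamma> \<delta>) M \<omega> = rounds c k \<gamma> \<delta>"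
    for \<omega> by (auto simp: num_rounds_def draws_bind queries_bind outcome_bind rounds_def)
  have nrt: "run_time (num_rounds c k \<gamma> \<delta>) M \<omega> \<le> 2 + (2 + (2 + (2 + (2 + 2))))"
    unfolding num_rounds_def by (intro run_time_bind_le) auto
  have gd: "draws ?g M \<omega> = n" and gq: "queries ?g M \<omega> = 0"
    and go: "outcome ?g M \<omega> = map \<omega> [0..<n]" and gt: "run_time ?g M \<omega> \<le> n * (2 + 2) + 1" for \<omega>
    using draws_for_each[of "[0..<n]" "\<lambda>_. Gauss Return" M 1 \<omega>]
      queries_for_each[of "[0..<n]" "\<lambda>_. Gauss Return" M 0 \<omega>]
      outcome_for_each[of "[0..<n]" "\<lambda>_. Gauss Return" M 1 \<omega>]
      run_time_for_each[of "[0..<n]" "\<lambda>_. Gauss Return" M 2 \<omega>] by auto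
  have fd: "draws ?f M \<omega> = n" and fq: "queries ?f M \<omega> = n + 1" for \<omega>
    by (simp_all add: draws_bind queries_bind gd gq go finite_differences_simps)
  have fo: "map_prod vec_of_list vec_of_list (outcome ?f M (\<lambda>j. \<omega> (j + i * n))) =
      (block n i \<omega>, quotients \<epsilon> n M (block n i \<omega>))" for \<omega> i
  proof -
    have "vec_of_list (map (\<lambda>j. \<omega> (j + i * n)) [0..<n]) = block n i \<omega>"
      by (auto simp: block_def vec_of_list_index intro!: eq_vecI)
    then show ?thesis
      by (simp add: outcome_bind gd go finite_differences_simps)
  qed
  have ft: "run_time ?f M \<omega> \<le> (n * (2 + 2) + 1) + ((2 * n * n + 12 * n + 4) + 1)" for \<omega>
    by (intro run_time_bind_le gt finite_differences_simps) (auto simp: go)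
  show "queries (span_recovery c \<epsilon> n k \<gamma> \<delta>) M \<omega> = rounds c k \<gamma> \<delta> * (n + 1)"
    using queries_for_each[of "[0..<rounds c k \<gamma> \<delta>]" "\<lambda>_. ?f" M "n + 1"] fq
    by (simp add: span_recovery_def queries_bind nr)
  show "map (map_prod vec_of_list vec_of_list) (outcome (span_recovery c \<epsilon> n k \<gamma> \<delta>) M \<omega>) =
       map (\<lambda>i. (block n i \<omega>, quotients \<epsilon> n M (block n i \<omega>))) [0..<rounds c k \<gamma> \<delta>]"
    using outcome_for_each[of "[0..<rounds c k \<gamma> \<delta>]" "\<lambda>_. ?f" M n] fd fo
    by (simp add: span_recovery_def outcome_bind nr)
  have "run_time (span_recovery c \<epsilon> n k \<gamma> \<delta>) M \<omega> \<le> 2 + (2 + (2 + (2 + (2 + 2)))) +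
      (length [0..<rounds c k \<gamma> \<delta>] *
         ((n * (2 + 2) + 1) + ((2 * n * n + 12 * n + 4) + 1) + 2) + 1)"
    unfolding span_recovery_def
    by (rule run_time_bind_le, rule nrt, unfold nr(3), rule run_time_for_each, rule ft)
  then show "run_time (span_recovery c \<epsilon> n k \<gamma> \<delta>) M \<omega> \<le>
      rounds c k \<gamma> \<delta> * (2 * n * n + 16 * n + 8) + 13"
    by (simp add: algebra_simps)
qed


section \<open>Spans, ranks and supports\<close>

abbreviation vspan :: "nat \<Rightarrow> real Matrix.vec set \<Rightarrow> real Matrix.vec set" where
  "vspan n \<equiv> LinearCombinations.module.span class_ring (module_vec TYPE(real) n)"

abbreviation vindep :: "nat \<Rightarrow> real Matrix.vec set \<Rightarrow> bool" where
  "vindep n S \<equiv> \<not> LinearCombinations.module.lin_dep class_ring (module_vec TYPE(real) n) S"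

section \<open>Gram determinants and rank\<close>

lemma scalar_prod_self_eq_0:
  fixes v :: "real Matrix.vec"
  assumes "v \<in> carrier_vec n" "v \<bullet> v = 0"
  shows "v = 0\<^sub>v n"
proof -
  have "(\<Sum>i<n. v $ i * v $ i) = 0"
    using assms by (simp add: scalar_prod_def lessThan_atLeast0)
  then have "\<forall>i<n. v $ i = 0"
    by (subst (asm) sum_nonneg_eq_0_iff) auto
  then show ?thesis using assms by auto
qed

text \<open>Pairing \<open>(B\<^sup>T * B) *\<^sub>v x = 0\<^sub>v m\<close> with \<open>x\<close>
  gives \<open>(B *\<^sub>v x) \<bullet> (B *\<^sub>v x) = 0\<close>, so over the reals
  \<open>B\<close> and its Gram matrix have the same kernel.\<close>

lemma det_gram_nonzero_iff:
  fixes B :: "real mat"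
  assumes B: "B \<in> carrier_mat n m"
  shows "det (B\<^sup>T * B) \<noteq> 0 \<longleftrightarrow> (\<forall>x\<in>carrier_vec m. B *\<^sub>v x = 0\<^sub>v n \<longrightarrow> x = 0\<^sub>v m)"
proof -
  have G: "B\<^sup>T * B \<in> carrier_mat m m" using B by auto
  have "(B\<^sup>T * B) *\<^sub>v x = 0\<^sub>v m \<longleftrightarrow> B *\<^sub>v x = 0\<^sub>v n" if x: "x \<in> carrier_vec m" for x
  proof
    have a: "(B\<^sup>T * B) *\<^sub>v x = B\<^sup>T *\<^sub>v (B *\<^sub>v x)"
      using B x by (intro assoc_mult_mat_vec) auto
    assume "(B\<^sup>T * B) *\<^sub>v x = 0\<^sub>v m"
    then have "(B\<^sup>T *\<^sub>v (B *\<^sub>v x)) \<bullet> x = 0" using a x by simp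
    then have "(B *\<^sub>v x) \<bullet> (B *\<^sub>v x) = 0"
      using transpose_vec_mult_scalar[OF B x, of "B *\<^sub>v x"] B x by simp
    then show "B *\<^sub>v x = 0\<^sub>v n"
      using B x by (intro scalar_prod_self_eq_0) auto
  next
    assume "B *\<^sub>v x = 0\<^sub>v n"
    then show "(B\<^sup>T * B) *\<^sub>v x = 0\<^sub>v m"
      using B x by (subst assoc_mult_mat_vec[of _ m n _ m]) auto
  qed
  then show ?thesis
    using det_0_iff_vec_prod_zero_field[OF G] by auto
qed

text \<open>Independence is a property of the set of columns, so distinctness has to be tracked
  separately: two equal columns put the difference of two unit vectors into the kernel.\<close>

lemma mat_of_cols_kernel_iff:
  assumes ts: "set ts \<subseteq> carrier_vec n"
  shows "(\<forall>x\<in>carrier_vec (length ts). mat_of_cols n ts *\<^sub>v x = 0\<^sub>v n \<longrightarrow> x = 0\<^sub>v (length ts)) \<longleftrightarrow>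
    distinct ts \<and> vindep n (set ts)" (is "?K \<longleftrightarrow> _")
proof -
  interpret vec_space "TYPE(real)" n .
  let ?B = "mat_of_cols n ts"
  have B: "?B \<in> carrier_mat n (length ts)" by simp
  have cols: "cols ?B = ts" using ts by simp
  have dist: "distinct ts" if K: ?K
  proof (rule ccontr)
    assume "\<not> distinct ts"
    then obtain a b where ab: "a < length ts" "b < length ts" "a \<noteq> b" "ts ! a = ts ! b"
      by (auto simp: distinct_conv_nth)
    let ?m = "length ts"
    let ?x = "unit_vec ?m a - unit_vec ?m b :: real Matrix.vec"
    have unit: "?B *\<^sub>v unit_vec ?m i = ts ! i" if "i < ?m" for i
    proof -
      have "ts ! i \<in> carrier_vec n" using ts nth_mem[OF that] by blast
      then show ?thesis using that by (intro eq_vecI) (auto simp: mat_of_cols_index)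
    qed
    have "?B *\<^sub>v ?x = ?B *\<^sub>v unit_vec ?m a - ?B *\<^sub>v unit_vec ?m b"
      using B by (intro mult_minus_distrib_mat_vec) auto
    also have "\<dots> = 0\<^sub>v n"
      using ab ts by (subst (1 2) unit) (auto simp: subset_eq)
    finally have "?x = 0\<^sub>v ?m" using K by auto
    then have "?x $ a = 0" using ab by simp
    then show False using ab by simp
  qed
  show ?thesis
  proof (cases "distinct ts")
    case True
    then show ?thesis
      using lin_depI[OF B] lin_depE[OF B] unfolding cols by metis
  qed (use dist in blast)
qed

text \<open>The rank is the size of a maximal independent set of columns, and independence passes to
  subsets, so every smaller cardinality occurs as well.\<close>

lemma rank_ge_iff:
  fixes zs :: "real Matrix.vec list"
  assumes zs: "set zs \<subseteq> carrier_vec n"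
  shows "m \<le> vec_space.rank n (mat_of_cols n zs) \<longleftrightarrow>
    (\<exists>T\<subseteq>set zs. vindep n T \<and> card T = m)"
proof -
  interpret vec_space "TYPE(real)" n .
  let ?B = "mat_of_cols n zs"
  have B: "?B \<in> carrier_mat n (length zs)" by simp
  have cols: "cols ?B = zs" using zs by simp
  obtain S where S: "maximal S (\<lambda>T. T \<subseteq> set (cols ?B) \<and> lin_indpt T)" "finite S"
    using maximal_exists_superset[of "set (cols ?B)" "\<lambda>T. T \<subseteq> set (cols ?B) \<and> lin_indpt T" "{}"]
      finite_lin_indpt2[of "{}"] by auto
  have r: "rank ?B = card S" by (rule rank_card_indpt[OF B S(1)])
  have S': "S \<subseteq> set zs" "lin_indpt S" using S(1) unfolding maximal_def cols by auto
  show ?thesis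
  proof
    assume "m \<le> rank ?B"
    then obtain T where T: "T \<subseteq> S" "card T = m"
      unfolding r using obtain_subset_with_card_n by metis
    then have "lin_indpt T" using S' subset_li_is_li by blast
    then show "\<exists>T\<subseteq>set zs. lin_indpt T \<and> card T = m" using T S' by blast
  next
    assume "\<exists>T\<subseteq>set zs. lin_indpt T \<and> card T = m"
    then show "m \<le> rank ?B" using rank_ge_card_indpt[OF B] unfolding cols by auto
  qed
qed

lemma subspace_dim_eq_rank:
  assumes "vec_of_list ` snd ` set gzs \<subseteq> carrier_vec n"
  shows "subspace_dim n (returned_subspace n gzs) =
    vec_space.rank n (mat_of_cols n (map (vec_of_list \<circ> snd) gzs))"
proof -
  interpret vec_space "TYPE(real)" n .
  have "cols (mat_of_cols n (map (vec_of_list \<circ> snd) gzs)) = map (vec_of_list \<circ> snd) gzs"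
    using assms by (subst cols_mat_of_cols) auto
  moreover have "(\<lambda>(g, z). vec_of_list z) = vec_of_list \<circ> (snd :: real list \<times> real list \<Rightarrow> _)"
    by auto
  ultimately show ?thesis
    unfolding subspace_dim_def returned_subspace_def rank_def by simp
qed

definition gram_mat :: "real Matrix.vec list \<Rightarrow> real mat" where
  "gram_mat ts = Matrix.mat (length ts) (length ts) (\<lambda>(i, j). ts ! i \<bullet> ts ! j)"

text \<open>Turns a lower bound on the rank into a finite disjunction of polynomial conditions on
  the coordinates. The index lists range over a set that depends only on \<open>m\<close> and the
  length of \<open>zs\<close>, hence not on the random vectors.\<close>

lemma rank_ge_iff_gram:
  assumes zs: "set zs \<subseteq> carrier_vec n"
  shows "m \<le> vec_space.rank n (mat_of_cols n zs) \<longleftrightarrow>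
    (\<exists>is\<in>{is. set is \<subseteq> {..<length zs} \<and> length is = m}. det (gram_mat (map ((!) zs) is)) \<noteq> 0)"
proof -
  have gram: "gram_mat ts = (mat_of_cols n ts)\<^sup>T * mat_of_cols n ts" if "set ts \<subseteq> carrier_vec n" for ts
  proof (rule eq_matI)
    fix i j assume "i < dim_row ((mat_of_cols n ts)\<^sup>T * mat_of_cols n ts)"
      "j < dim_col ((mat_of_cols n ts)\<^sup>T * mat_of_cols n ts)"
    then have ij: "i < length ts" "j < length ts" by simp_all
    then have "ts ! i \<in> carrier_vec n" "ts ! j \<in> carrier_vec n"
      using that by (meson nth_mem subsetD)+
    then show "gram_mat ts $$ (i, j) = ((mat_of_cols n ts)\<^sup>T * mat_of_cols n ts) $$ (i, j)"
      using ij by (simp add: gram_mat_def)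
  qed (simp_all add: gram_mat_def)
  have indep: "det (gram_mat ts) \<noteq> 0 \<longleftrightarrow> distinct ts \<and> vindep n (set ts)"
    if "set ts \<subseteq> carrier_vec n" for ts
    unfolding gram[OF that] det_gram_nonzero_iff[OF mat_of_cols_carrier(1)]
      mat_of_cols_kernel_iff[OF that] ..
  have "\<exists>is\<in>{is. set is \<subseteq> {..<length zs} \<and> length is = m}. det (gram_mat (map ((!) zs) is)) \<noteq> 0"
    if T: "T \<subseteq> set zs" "vindep n T" "card T = m" for T
  proof -
    obtain ts where ts: "set ts = T" "distinct ts"
      using finite_distinct_list finite_subset[OF T(1)] by blast
    have "\<forall>t\<in>set ts. \<exists>i<length zs. zs ! i = t"
      using T(1) ts(1) by (metis in_set_conv_nth subsetD)
    then obtain f where f: "\<forall>t\<in>set ts. f t < length zs \<and> zs ! f t = t" by metis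
    have eq: "map ((!) zs) (map f ts) = ts" using f by (simp add: map_idI)
    have "set ts \<subseteq> carrier_vec n" using T(1) ts(1) zs by blast
    then have "det (gram_mat (map ((!) zs) (map f ts))) \<noteq> 0"
      unfolding eq using indep[of ts] T(2) ts by blast
    moreover have "length ts = m" using ts T(3) distinct_card by metis
    moreover have "set (map f ts) \<subseteq> {..<length zs}" using f by auto
    ultimately show ?thesis by (intro bexI[of _ "map f ts"]) simp_all
  qed
  moreover have "\<exists>T\<subseteq>set zs. vindep n T \<and> card T = m"
    if i: "set is \<subseteq> {..<length zs}" "length is = m" "det (gram_mat (map ((!) zs) is)) \<noteq> 0" for "is"
  proof -
    let ?ts = "map ((!) zs) is"
    have sub: "set ?ts \<subseteq> set zs" using i(1) by auto
    then have "set ?ts \<subseteq> carrier_vec n" using zs by blast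
    then have *: "distinct ?ts" "vindep n (set ?ts)" using indep[of ?ts] i(3) by blast+
    have "card (set ?ts) = m" using distinct_card[OF *(1)] i(2) by simp
    then show ?thesis using sub *(2) by blast
  qed
  ultimately show ?thesis unfolding rank_ge_iff[OF zs] by blast
qed

text \<open>Some \<open>k\<close> independent columns of \<open>A\<close> form an invertible square
  matrix \<open>?B\<close>; the entries of \<open>?B\<^sup>T *\<^sub>v x\<close> are among those of
  \<open>A\<^sup>T *\<^sub>v x\<close>, all of which vanish.\<close>

lemma full_row_rank_transpose_inj:
  fixes A :: "real mat"
  assumes A: "A \<in> carrier_mat k n" and rank: "vec_space.rank k A = k"
    and x: "x \<in> carrier_vec k" "A\<^sup>T *\<^sub>v x = 0\<^sub>v n"
  shows "x = 0\<^sub>v k"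
proof -
  have colsA: "set (cols A) \<subseteq> carrier_vec k" using A cols_dim by blast
  have "mat_of_cols k (cols A) = A" using A by auto
  then obtain T where T: "T \<subseteq> set (cols A)" "vindep k T" "card T = k"
    using rank_ge_iff[OF colsA, of k] rank by auto
  obtain ts where ts: "set ts = T" "distinct ts"
    using finite_distinct_list finite_subset[OF T(1)] by blast
  have len: "length ts = k" using ts T distinct_card by metis
  let ?B = "mat_of_cols k ts"
  have B: "?B \<in> carrier_mat k k" using len mat_of_cols_carrier(1)[of k ts] by simp
  have tsk: "set ts \<subseteq> carrier_vec k" using T ts colsA by auto
  have "\<forall>y\<in>carrier_vec k. ?B *\<^sub>v y = 0\<^sub>v k \<longrightarrow> y = 0\<^sub>v k"
    using mat_of_cols_kernel_iff[OF tsk] ts T len by auto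
  then have "det ?B \<noteq> 0" using det_0_iff_vec_prod_zero_field[OF B] by blast
  then have "det ?B\<^sup>T \<noteq> 0" using det_transpose[OF B] by simp
  moreover have "?B\<^sup>T *\<^sub>v x = 0\<^sub>v k"
  proof (rule eq_vecI)
    fix i assume i: "i < dim_vec (0\<^sub>v k)"
    then have "ts ! i \<in> set (cols A)" using T ts len by (metis index_zero_vec(2) nth_mem subsetD)
    then obtain j where j: "j < n" "ts ! i = col A j"
      using A by (auto simp: cols_def)
    have "ts ! i \<bullet> x = (A\<^sup>T *\<^sub>v x) $ j" using j A by auto
    then have "ts ! i \<bullet> x = 0" using x j by simp
    then show "(?B\<^sup>T *\<^sub>v x) $ i = 0\<^sub>v k $ i"
      using i len tsk by (auto simp: subset_eq)
  qed (use len in auto)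
  moreover have "?B\<^sup>T \<in> carrier_mat k k" using B by simp
  ultimately show ?thesis
    using det_0_iff_vec_prod_zero_field x(1) by blast
qed

text \<open>The matrix is the orthogonal projection \<open>A\<^sup>T (A A\<^sup>T)^-1 A\<close>. It
  replaces the existential membership in the row space by an equation between vectors, whose
  measurability is evident.\<close>

lemma row_space_projection:
  fixes A :: "real mat"
  assumes A: "A \<in> carrier_mat k n" and rank: "vec_space.rank k A = k"
  obtains P where "P \<in> carrier_mat n n"
    "\<And>z. z \<in> carrier_vec n \<Longrightarrow> z \<in> vec_space.row_space n A \<longleftrightarrow> P *\<^sub>v z = z"
proof -
  interpret vec_space "TYPE(real)" n .
  have At: "A\<^sup>T \<in> carrier_mat n k" and G: "A * A\<^sup>T \<in> carrier_mat k k" using A by auto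
  have "det ((A\<^sup>T)\<^sup>T * A\<^sup>T) \<noteq> 0"
    unfolding det_gram_nonzero_iff[OF At] using full_row_rank_transpose_inj[OF A rank] by blast
  then have "A * A\<^sup>T \<in> Units (ring_mat TYPE(real) k ())"
    using det_non_zero_imp_unit[OF G] by simp
  then obtain R where R: "R \<in> carrier_mat k k" "R * (A * A\<^sup>T) = 1\<^sub>m k"
    by (auto simp: Units_def ring_mat_def)
  define P where "P = A\<^sup>T * (R * A)"
  have P: "P \<in> carrier_mat n n" using A R by (auto simp: P_def)
  have "z \<in> row_space A \<longleftrightarrow> P *\<^sub>v z = z" if z: "z \<in> carrier_vec n" for z
  proof
    assume "z \<in> row_space A"
    then obtain y where y: "y \<in> carrier_vec k" "z = A\<^sup>T *\<^sub>v y" using A row_space_eq[OF A] by auto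
    have "P *\<^sub>v z = A\<^sup>T *\<^sub>v ((R * A) *\<^sub>v (A\<^sup>T *\<^sub>v y))"
      using A R y unfolding P_def y(2) by (intro assoc_mult_mat_vec) auto
    also have "(R * A) *\<^sub>v (A\<^sup>T *\<^sub>v y) = ((R * A) * A\<^sup>T) *\<^sub>v y"
      using A R y by (intro assoc_mult_mat_vec[symmetric]) auto
    also have "(R * A) * A\<^sup>T = 1\<^sub>m k" using A R by (simp add: assoc_mult_mat[of _ k k _ n])
    finally show "P *\<^sub>v z = z" using y by simp
  next
    assume "P *\<^sub>v z = z"
    then have "z = A\<^sup>T *\<^sub>v ((R * A) *\<^sub>v z)"
      using A R z unfolding P_def by (subst (asm) assoc_mult_mat_vec[of _ n k _ n]) auto
    moreover have "(R * A) *\<^sub>v z \<in> carrier_vec k"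
      using A R z by (intro mult_mat_vec_carrier[of _ k n]) auto
    ultimately have "\<exists>y\<in>carrier_vec k. A\<^sup>T *\<^sub>v y = z" by metis
    then show "z \<in> row_space A" using A z row_space_eq[OF A] by simp
  qed
  then show ?thesis using that P by blast
qed

text \<open>Adding \<open>T\<close> to \<open>U\<close> does not enlarge the span, so the rank of
  all these columns together is at least \<open>card T\<close> and at most
  \<open>card U\<close>.\<close>

lemma card_le_card_spanning:
  assumes U: "finite U" "U \<subseteq> carrier_vec n" and T: "T \<subseteq> vspan n U" "vindep n T" "finite T"
  shows "card T \<le> card U"
proof -
  interpret vec_space "TYPE(real)" n .
  obtain us where us: "set us = U" "distinct us" using finite_distinct_list[OF U(1)] by blast
  obtain ts where ts: "set ts = T" using finite_list[OF T(3)] by blast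
  have Tn: "T \<subseteq> carrier_vec n" using T(1) span_closed[OF U(2)] by blast
  have "span (U \<union> T) \<subseteq> span U"
    using U T in_own_span[OF U(2)] by (intro span_subsetI) auto
  moreover have "span U \<subseteq> span (U \<union> T)" by (intro span_is_monotone) auto
  ultimately have eq: "span (T \<union> U) = span U" by (simp add: Un_commute)
  have "card T \<le> rank (mat_of_cols n (ts @ us))"
    using rank_ge_card_indpt[of "mat_of_cols n (ts @ us)" "length (ts @ us)" T] T ts us U Tn
    by (auto simp del: length_append)
  also have "\<dots> = rank (mat_of_cols n us)"
    using ts us U Tn eq by (simp add: rank_def)
  also have "\<dots> \<le> length us" using rank_le_nc[of "mat_of_cols n us" "length us"] by simp
  finally show ?thesis using us distinct_card by metis
qed

lemma vindep_insert:
  assumes "U \<subseteq> carrier_vec n" "vindep n U" "z \<in> carrier_vec n" "z \<notin> vspan n U"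
  shows "vindep n (insert z U)"
proof -
  interpret vec_space "TYPE(real)" n .
  have "z \<notin> U" using in_own_span[of U] assms by auto
  then show ?thesis using lin_dep_iff_in_span[of U z] assms by auto
qed

section \<open>Supports met by a low-dimensional subspace\<close>

definition support :: "real Matrix.vec \<Rightarrow> nat set" where
  "support c = {i. i < dim_vec c \<and> c $ i \<noteq> 0}"

text \<open>Complementation is injective and sends a set of at most \<open>d\<close> elements to one
  of at least \<open>k - d > d\<close>. The small sets and their complements are therefore disjoint
  families of equal size, and the small ones make up at most half of all subsets.\<close>

lemma card_small_subsets:
  assumes "2 * d < k"
  shows "card {B. B \<subseteq> {..<k} \<and> card B \<le> d} \<le> 2 ^ (k - 1)"
proof -
  let ?F = "{B. B \<subseteq> {..<k} \<and> card B \<le> d}" and ?c = "\<lambda>B. {..<k} - B"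
  have fin: "finite ?F" by (rule finite_subset[of _ "Pow {..<k}"]) auto
  have "inj_on ?c ?F" by (rule inj_onI) blast
  then have "card (?c ` ?F) = card ?F" by (rule card_image)
  moreover have "?F \<inter> ?c ` ?F = {}"
  proof -
    have "card ({..<k} - B) > d" if "B \<subseteq> {..<k}" "card B \<le> d" for B
      using card_Diff_subset[OF finite_subset[OF that(1)] that(1)] that(2) assms by simp
    then have "\<not> card ({..<k} - B) \<le> d" if "B \<in> ?F" for B
      using that by (simp add: not_le)
    then show ?thesis by blast
  qed
  ultimately have "2 * card ?F = card (?F \<union> ?c ` ?F)"
    using fin by (subst card_Un_disjoint) auto
  also have "\<dots> \<le> card (Pow {..<k})" by (intro card_mono) auto
  finally have "2 * card ?F \<le> 2 ^ k" by (simp add: card_Pow)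
  then show ?thesis using assms by (cases k) auto
qed

text \<open>The vectors \<open>c\<close> with \<open>A\<^sup>T c \<in> span U\<close> form a space \<open>V\<close> of dimension at most \<open>card U\<close>.  The
  zero set of such a vector is a flat of the linear matroid of the coordinate functionals on \<open>V\<close>,
  so it is determined by a basis of the flat, which is a set of at most \<open>card U\<close> coordinates.\<close>

lemma card_supports_le:
  fixes A :: "real mat"
  assumes A: "A \<in> carrier_mat k n" and rank: "vec_space.rank k A = k"
    and U: "finite U" "U \<subseteq> carrier_vec n" "2 * card U < k"
  shows "card {support c |c. c \<in> carrier_vec k \<and> A\<^sup>T *\<^sub>v c \<in> vspan n U} \<le> 2 ^ (k - 1)"
proof -
  interpret vec_space "TYPE(real)" n .
  define V' where "V' = {c \<in> carrier_vec k. A\<^sup>T *\<^sub>v c \<in> span U}"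
  \<comment> \<open>The closure in the matroid of coordinate functionals: the coordinates forced to
    vanish on \<open>V'\<close> once those in \<open>B\<close> do.\<close>
  define cl where "cl B = {i. i < k \<and> (\<forall>c\<in>V'. (\<forall>j\<in>B. c $ j = 0) \<longrightarrow> c $ i = 0)}" for B
  \<comment> \<open>Vectors \<open>v b\<close> that are dual to the coordinates in \<open>B\<close>
    up to scaling are independent, the injective map \<open>A\<^sup>T\<close> keeps them so, and
    their images lie in the span of \<open>U\<close>.\<close>
  have indep: "card B \<le> card U"
    if B: "B \<subseteq> {..<k}" and v: "\<And>b. b \<in> B \<Longrightarrow> v b \<in> V' \<and> v b $ b \<noteq> 0 \<and> (\<forall>j\<in>B - {b}. v b $ j = 0)"
    for B v
  proof -
    obtain bs where bs: "set bs = B" "distinct bs"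
      using finite_distinct_list finite_subset[OF B] by blast
    let ?m = "length bs" and ?C = "mat_of_cols k (map v bs)" and ?ts = "map (\<lambda>b. A\<^sup>T *\<^sub>v v b) bs"
    have vk: "v b \<in> carrier_vec k" if "b \<in> B" for b using v[OF that] by (simp add: V'_def)
    have tsn: "set ?ts \<subseteq> carrier_vec n"
      using A vk bs by (auto intro!: mult_mat_vec_carrier[of _ n k])
    have C: "?C \<in> carrier_mat k ?m" using mat_of_cols_carrier(1)[of k "map v bs"] by simp
    have prod: "mat_of_cols n ?ts = A\<^sup>T * ?C"
      using A vk bs by (intro eq_matI) (auto simp: mat_of_cols_index)
    have "x = 0\<^sub>v ?m" if x: "x \<in> carrier_vec ?m" "mat_of_cols n ?ts *\<^sub>v x = 0\<^sub>v n" for x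
    proof (rule eq_vecI)
      have "A\<^sup>T *\<^sub>v (?C *\<^sub>v x) = 0\<^sub>v n"
        using x A C unfolding prod by (subst (asm) assoc_mult_mat_vec[of _ n k _ ?m]) auto
      then have z: "?C *\<^sub>v x = 0\<^sub>v k"
        using full_row_rank_transpose_inj[OF A rank] mult_mat_vec_carrier[OF C x(1)] by blast
      fix i assume i: "i < dim_vec (0\<^sub>v ?m)"
      then have bi: "bs ! i \<in> B" "bs ! i < k" using bs B by auto
      \<comment> \<open>Evaluation at coordinate \<open>bs ! i\<close> isolates one term, since all
        other \<open>v (bs ! j)\<close> vanish there.\<close>
      have "0 = (?C *\<^sub>v x) $ (bs ! i)" using z bi by simp
      also have "\<dots> = (\<Sum>j<?m. v (bs ! j) $ (bs ! i) * x $ j)"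
        using x bi by (auto simp: scalar_prod_def mat_of_cols_index lessThan_atLeast0 intro!: sum.cong)
      also have "\<dots> = (\<Sum>j<?m. if j = i then v (bs ! i) $ (bs ! i) * x $ i else 0)"
      proof (intro sum.cong refl)
        fix j assume "j \<in> {..<?m}"
        then show "v (bs ! j) $ (bs ! i) * x $ j = (if j = i then v (bs ! i) $ (bs ! i) * x $ i else 0)"
          using v[of "bs ! j"] bi bs i by (auto simp: nth_eq_iff_index_eq)
      qed
      also have "\<dots> = v (bs ! i) $ (bs ! i) * x $ i" using i by simp
      finally show "x $ i = 0\<^sub>v ?m $ i" using v[OF bi(1)] i by simp
    qed (use x in simp)
    then have "distinct ?ts" "lin_indpt (set ?ts)" using mat_of_cols_kernel_iff[OF tsn] by auto
    then have "card (set ?ts) = card B" "card (set ?ts) \<le> card U"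
      using bs distinct_card[of ?ts] distinct_card[of bs] card_le_card_spanning[OF U(1,2), of "set ?ts"] v
      by (auto simp: V'_def)
    then show ?thesis by simp
  qed
  have ex: "\<exists>B\<subseteq>{..<k}. card B \<le> card U \<and> support c = {..<k} - cl B" if c: "c \<in> V'" for c
  proof -
    define Z where "Z = {..<k} - support c"
    have ck: "dim_vec c = k" using c by (auto simp: V'_def)
    \<comment> \<open>A set \<open>B\<close> of least size among the subsets of \<open>Z\<close>
      whose closure covers \<open>Z\<close> is a basis of the flat \<open>Z\<close>; minimality
      supplies the vectors that \<open>indep\<close> asks for.\<close>
    define Q where "Q B \<longleftrightarrow> B \<subseteq> Z \<and> Z \<subseteq> cl B" for B
    have Zk: "Z \<subseteq> {..<k}" by (auto simp: Z_def)
    have "Q Z" using Zk by (auto simp: Q_def cl_def)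
    then obtain B where B: "Q B" "\<And>B'. Q B' \<Longrightarrow> card B \<le> card B'"
      using ex_has_least_nat[of Q Z card] by blast
    have BZ: "B \<subseteq> Z" "finite B" using B(1) Zk finite_subset[of B "{..<k}"] by (auto simp: Q_def)
    have "\<exists>v. v \<in> V' \<and> v $ b \<noteq> 0 \<and> (\<forall>j\<in>B - {b}. v $ j = 0)" if b: "b \<in> B" for b
    proof -
      have "card (B - {b}) < card B" using BZ b by (meson card_Diff1_less)
      then have "\<not> Q (B - {b})" using B(2)[of "B - {b}"] by linarith
      then obtain i where i: "i \<in> Z" "i \<notin> cl (B - {b})" using BZ by (auto simp: Q_def)
      then obtain v where v: "v \<in> V'" "\<forall>j\<in>B - {b}. v $ j = 0" "v $ i \<noteq> 0"
        using Zk by (auto simp: cl_def)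
      have "i \<in> cl B" using B(1) i(1) by (auto simp: Q_def)
      \<comment> \<open>\<open>v\<close> vanishes on the rest of \<open>B\<close> but not at
        \<open>i\<close>, which lies in the closure of \<open>B\<close>; so it cannot vanish at
        \<open>b\<close>.\<close>
      then have "v $ b \<noteq> 0" using v by (auto simp: cl_def)
      then show ?thesis using v by blast
    qed
    then obtain v where "\<And>b. b \<in> B \<Longrightarrow> v b \<in> V' \<and> v b $ b \<noteq> 0 \<and> (\<forall>j\<in>B - {b}. v b $ j = 0)"
      by metis
    then have "card B \<le> card U" using indep[of B v] BZ Zk by auto
    moreover have "support c = {..<k} - cl B"
    proof -
      have "\<forall>j\<in>B. c $ j = 0" using BZ(1) ck by (auto simp: Z_def support_def)
      \<comment> \<open>\<open>c\<close> itself lies in \<open>V'\<close> and vanishes on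
        \<open>B\<close>, hence on all of \<open>cl B\<close>.\<close>
      then have "cl B \<subseteq> Z" using c ck by (auto simp: cl_def Z_def support_def)
      then have "cl B = Z" using B(1) by (auto simp: Q_def)
      then show ?thesis using ck by (auto simp: Z_def support_def)
    qed
    ultimately show ?thesis using BZ Zk by blast
  qed
  have "{support c |c. c \<in> carrier_vec k \<and> A\<^sup>T *\<^sub>v c \<in> span U} \<subseteq>
      (\<lambda>B. {..<k} - cl B) ` {B. B \<subseteq> {..<k} \<and> card B \<le> card U}"
  proof safe
    fix c assume "c \<in> carrier_vec k" "A\<^sup>T *\<^sub>v c \<in> span U"
    then have "c \<in> V'" by (simp add: V'_def)
    then obtain B where "B \<subseteq> {..<k}" "card B \<le> card U" "support c = {..<k} - cl B"
      using ex by blast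
    then show "support c \<in> (\<lambda>B. {..<k} - cl B) ` {B. B \<subseteq> {..<k} \<and> card B \<le> card U}"
      by blast
  qed
  then have "card {support c |c. c \<in> carrier_vec k \<and> A\<^sup>T *\<^sub>v c \<in> span U} \<le>
      card ((\<lambda>B. {..<k} - cl B) ` {B. B \<subseteq> {..<k} \<and> card B \<le> card U})"
    by (intro card_mono finite_imageI) (auto intro: finite_subset[of _ "Pow {..<k}"])
  also have "\<dots> \<le> card {B. B \<subseteq> {..<k} \<and> card B \<le> card U}"
    by (intro card_image_le) (auto intro: finite_subset[of _ "Pow {..<k}"])
  also have "\<dots> \<le> 2 ^ (k - 1)" by (rule card_small_subsets[OF U(3)])
  finally show ?thesis .
qed


section \<open>Networks are locally linear\<close>

text \<open>Strict positivity makes this the set of non-zero coordinates of \<open>relu y\<close>,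
  so the same sets serve as row masks and as sign patterns.\<close>

definition pos :: "real Matrix.vec \<Rightarrow> nat set" where
  "pos y = {i. i < dim_vec y \<and> 0 < y $ i}"

abbreviation hidden :: "real mat list \<Rightarrow> real mat \<Rightarrow> real Matrix.vec \<Rightarrow> real Matrix.vec" where
  "hidden Ws A x \<equiv> foldr (\<lambda>W y. relu (W *\<^sub>v y)) Ws (relu (A *\<^sub>v x))"

primrec patterns :: "real mat list \<Rightarrow> real mat \<Rightarrow> real Matrix.vec \<Rightarrow> nat set list" where
  "patterns [] A x = []"
| "patterns (W # Ws) A x = pos (W *\<^sub>v hidden Ws A x) # patterns Ws A x"

abbreviation mask_prod :: "real mat list \<Rightarrow> nat set list \<Rightarrow> real mat \<Rightarrow> real mat" where
  "mask_prod Ws Ss B \<equiv> foldr (*) (map2 mask_rows Ss Ws) B"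

text \<open>Defined at every point, also where the network is not differentiable; it is the
  derivative of \<open>hidden\<close> wherever the patterns are locally constant.\<close>

definition linear_part :: "real mat list \<Rightarrow> real mat \<Rightarrow> real Matrix.vec \<Rightarrow> real mat" where
  "linear_part Ws A x = mask_prod Ws (patterns Ws A x) (mask_rows (pos (A *\<^sub>v x)) A)"

text \<open>A recursive form of the shape condition, so that inductions can strip the outermost
  matrix; \<open>hd (ks @ [k])\<close> is the output dimension of the remaining network, which is
  \<open>k\<close> once no matrix is left.\<close>

fun layers :: "nat list \<Rightarrow> nat \<Rightarrow> real mat list \<Rightarrow> bool" where
  "layers [] k [] \<longleftrightarrow> True"
| "layers (a # ks) k (W # Ws) \<longleftrightarrow> W \<in> carrier_mat a (hd (ks @ [k])) \<and> layers ks k Ws"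
| "layers _ _ _ \<longleftrightarrow> False"

lemma layers_iff:
  "layers ks k Ws \<longleftrightarrow> length Ws = length ks \<and>
    (\<forall>i<length ks. Ws ! i \<in> carrier_mat ((ks @ [k]) ! i) ((ks @ [k]) ! Suc i))"
proof (induction ks k Ws rule: layers.induct)
  case (2 a ks k W Ws)
  have "hd (ks @ [k]) = (ks @ [k]) ! 0" by (simp add: hd_conv_nth)
  then show ?case using 2 by (auto simp: All_less_Suc2)
qed auto

lemma network_shape_iff:
  "network_shape n k ks w Ws A \<longleftrightarrow>
     A \<in> carrier_mat k n \<and> layers ks k Ws \<and> w \<in> carrier_vec (hd (ks @ [k]))"
  by (auto simp: network_shape_def layers_iff hd_conv_nth)

lemma relu_carrier [simp]: "relu y \<in> carrier_vec m \<longleftrightarrow> y \<in> carrier_vec m"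
  by (simp add: relu_def)

lemma relu_index [simp]: "i < dim_vec y \<Longrightarrow> relu y $ i = max 0 (y $ i)"
  and dim_relu [simp]: "dim_vec (relu y) = dim_vec y"
  by (simp_all add: relu_def)

lemma mask_rows_carrier [simp]: "mask_rows S W \<in> carrier_mat a b \<longleftrightarrow> W \<in> carrier_mat a b"
  by (simp only: mask_rows_def carrier_mat_def mem_Collect_eq dim_row_mat dim_col_mat)

lemma mask_rows_index:
  "i < dim_row W \<Longrightarrow> j < dim_col W \<Longrightarrow> mask_rows S W $$ (i, j) = (if i \<in> S then W $$ (i, j) else 0)"
  by (simp add: mask_rows_def)

lemma dim_mask_rows [simp]: "dim_row (mask_rows S W) = dim_row W" "dim_col (mask_rows S W) = dim_col W"
  by (simp_all add: mask_rows_def)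

lemma relu_eq_mask_rows:
  assumes "W \<in> carrier_mat a b" "y \<in> carrier_vec b"
  shows "relu (W *\<^sub>v y) = mask_rows (pos (W *\<^sub>v y)) W *\<^sub>v y"
proof (rule eq_vecI)
  fix i assume "i < dim_vec (mask_rows (pos (W *\<^sub>v y)) W *\<^sub>v y)"
  then have i: "i < a" using assms by simp
  have "row (mask_rows S W) i = (if i \<in> S then row W i else 0\<^sub>v b)" for S
    using assms i by (intro eq_vecI) (auto simp: mask_rows_index)
  then show "relu (W *\<^sub>v y) $ i = (mask_rows (pos (W *\<^sub>v y)) W *\<^sub>v y) $ i"
    using assms i by (auto simp: pos_def)
qed (use assms in simp)

lemma hidden_carrier:
  assumes "layers ks k Ws" "A \<in> carrier_mat k n" "x \<in> carrier_vec n"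
  shows "hidden Ws A x \<in> carrier_vec (hd (ks @ [k]))"
  using assms
proof (induction ks k Ws rule: layers.induct)
  case (2 a ks k W Ws)
  then show ?case using mult_mat_vec_carrier[of W a "hd (ks @ [k])"] by simp
next
  case (1 k)
  show ?case using mult_mat_vec_carrier[OF 1(2,3)] by simp
qed auto

lemma mask_prod_carrier:
  assumes "layers ks k Ws" "length Ss = length ks" "B \<in> carrier_mat k n"
  shows "mask_prod Ws Ss B \<in> carrier_mat (hd (ks @ [k])) n"
  using assms
proof (induction ks k Ws arbitrary: Ss rule: layers.induct)
  case (2 a ks k W Ws)
  then obtain S Ss' where Ss: "Ss = S # Ss'" by (cases Ss) auto
  have "mask_prod Ws Ss' B \<in> carrier_mat (hd (ks @ [k])) n" using 2 Ss by auto
  moreover have "mask_rows S W \<in> carrier_mat a (hd (ks @ [k]))" using 2 by simp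
  ultimately show ?case using mult_carrier_mat by (simp add: Ss)
qed auto

text \<open>Assumption 2 concerns the product that ends in the identity, whereas
  \<open>linear_part\<close> ends in the masked \<open>A\<close>; the last factor is therefore split
  off.\<close>

lemma mask_prod_mult:
  assumes "layers ks k Ws" "length Ss = length ks" "B \<in> carrier_mat k n"
  shows "mask_prod Ws Ss B = mask_prod Ws Ss (1\<^sub>m k) * B"
  using assms
proof (induction ks k Ws arbitrary: Ss rule: layers.induct)
  case (2 a ks k W Ws)
  then obtain S Ss' where Ss: "Ss = S # Ss'" by (cases Ss) auto
  have c: "mask_prod Ws Ss' (1\<^sub>m k) \<in> carrier_mat (hd (ks @ [k])) k"
    using 2 Ss by (intro mask_prod_carrier) auto
  have W: "mask_rows S W \<in> carrier_mat a (hd (ks @ [k]))" using 2 by simp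
  show ?case using 2 Ss assoc_mult_mat[OF W c "2.prems"(3)] by simp
qed auto

lemma length_patterns: "layers ks k Ws \<Longrightarrow> length (patterns Ws A x) = length ks"
  by (induction ks k Ws rule: layers.induct) auto

lemma linear_part_carrier:
  assumes "layers ks k Ws" "A \<in> carrier_mat k n"
  shows "linear_part Ws A x \<in> carrier_mat (hd (ks @ [k])) n"
  unfolding linear_part_def using assms
  by (intro mask_prod_carrier[OF assms(1) length_patterns[OF assms(1)]]) simp

lemma linear_part_Nil: "linear_part [] A x = mask_rows (pos (A *\<^sub>v x)) A"
  and linear_part_Cons: "linear_part (W # Ws) A x =
    mask_rows (pos (W *\<^sub>v hidden Ws A x)) W * linear_part Ws A x"
  by (simp_all add: linear_part_def)

lemma hidden_eq_linear_part:
  assumes "layers ks k Ws" "A \<in> carrier_mat k n" "x \<in> carrier_vec n"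
  shows "hidden Ws A x = linear_part Ws A x *\<^sub>v x"
  using assms
proof (induction ks k Ws rule: layers.induct)
  case (1 k)
  then show ?case by (simp add: linear_part_Nil relu_eq_mask_rows)
next
  case (2 a ks k W Ws)
  have W: "W \<in> carrier_mat a (hd (ks @ [k]))" and L: "layers ks k Ws" using 2 by simp_all
  have h: "hidden Ws A x \<in> carrier_vec (hd (ks @ [k]))" using 2 L by (intro hidden_carrier) auto
  have Wm: "mask_rows S W \<in> carrier_mat a (hd (ks @ [k]))" for S using W by simp
  have "hidden (W # Ws) A x = mask_rows (pos (W *\<^sub>v hidden Ws A x)) W *\<^sub>v hidden Ws A x"
    using relu_eq_mask_rows[OF W h] by simp
  also have "\<dots> = mask_rows (pos (W *\<^sub>v hidden Ws A x)) W *\<^sub>v (linear_part Ws A x *\<^sub>v x)"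
    using 2 L by simp
  also have "\<dots> = linear_part (W # Ws) A x *\<^sub>v x"
    unfolding linear_part_Cons
    using assoc_mult_mat_vec[OF Wm linear_part_carrier[OF L] "2.prems"(3)] 2 by simp
  finally show ?case .
qed simp_all

primrec linear_parts :: "real mat list \<Rightarrow> real mat \<Rightarrow> real mat set" where
  "linear_parts [] A = (\<lambda>S. mask_rows S A) ` Pow {..<dim_row A}"
| "linear_parts (W # Ws) A = (\<lambda>(S, B). mask_rows S W * B) ` (Pow {..<dim_row W} \<times> linear_parts Ws A)"

text \<open>Normal vectors of the candidate hyperplanes: on each linear piece of the inner layers, a
  pre-activation is the scalar product of the input with one of them.\<close>

primrec preactivations :: "real mat list \<Rightarrow> real mat \<Rightarrow> real Matrix.vec set" where
  "preactivations [] A = row A ` {..<dim_row A}"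
| "preactivations (W # Ws) A = preactivations Ws A \<union>
    (\<lambda>(i, B). row (W * B) i) ` ({..<dim_row W} \<times> linear_parts Ws A)"

section \<open>Counting linear pieces and hyperplanes\<close>

primrec num_linear_parts :: "nat list \<Rightarrow> nat \<Rightarrow> nat" where
  "num_linear_parts [] k = 2 ^ k"
| "num_linear_parts (a # ks) k = 2 ^ a * num_linear_parts ks k"

primrec num_preactivations :: "nat list \<Rightarrow> nat \<Rightarrow> nat" where
  "num_preactivations [] k = k"
| "num_preactivations (a # ks) k = num_preactivations ks k + a * num_linear_parts ks k"

lemma linear_parts_finite_card:
  assumes "layers ks k Ws" "A \<in> carrier_mat k n"
  shows "finite (linear_parts Ws A) \<and> card (linear_parts Ws A) \<le> num_linear_parts ks k"
  using assms
proof (induction ks k Ws rule: layers.induct)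
  case (1 k)
  have "card (linear_parts [] A) \<le> card (Pow {..<dim_row A})"
    unfolding linear_parts.simps by (rule card_image_le) simp
  then show ?case using 1 by (simp add: card_Pow)
next
  case (2 a ks k W Ws)
  have fin: "finite (Pow {..<dim_row W} \<times> linear_parts Ws A)" using 2 by simp
  have "card (linear_parts (W # Ws) A) \<le> card (Pow {..<dim_row W} \<times> linear_parts Ws A)"
    unfolding linear_parts.simps by (rule card_image_le[OF fin])
  also have "\<dots> = 2 ^ a * card (linear_parts Ws A)"
    using carrier_matD(1)[of W a] 2 by (auto simp: card_cartesian_product card_Pow)
  also have "\<dots> \<le> num_linear_parts (a # ks) k" using 2 by simp
  finally show ?case using fin by simp
qed simp_all

lemma preactivations_finite_card:
  assumes "layers ks k Ws" "A \<in> carrier_mat k n"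
  shows "finite (preactivations Ws A) \<and> card (preactivations Ws A) \<le> num_preactivations ks k"
  using assms
proof (induction ks k Ws rule: layers.induct)
  case (1 k)
  have "card (preactivations [] A) \<le> card {..<dim_row A}"
    unfolding preactivations.simps by (rule card_image_le) simp
  then show ?case using 1 by simp
next
  case (2 a ks k W Ws)
  let ?P = "{..<dim_row W} \<times> linear_parts Ws A"
  have lp: "finite (linear_parts Ws A)" "card (linear_parts Ws A) \<le> num_linear_parts ks k"
    using linear_parts_finite_card[of ks k Ws A n] 2 by simp_all
  have "card ((\<lambda>(i, B). row (W * B) i) ` ?P) \<le> card ?P"
    using lp by (intro card_image_le) simp
  also have "\<dots> \<le> a * num_linear_parts ks k"
    using lp carrier_matD(1)[of W a] 2 by (auto simp: card_cartesian_product)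
  finally show ?case
    using 2 lp card_Un_le[of "preactivations Ws A" "(\<lambda>(i, B). row (W * B) i) ` ?P"] by simp
qed simp_all

lemma preactivations_carrier:
  assumes "layers ks k Ws" "A \<in> carrier_mat k n"
  shows "preactivations Ws A \<subseteq> carrier_vec n"
    and linear_parts_carrier: "linear_parts Ws A \<subseteq> carrier_mat (hd (ks @ [k])) n"
  using assms
proof (induction ks k Ws rule: layers.induct)
  case (2 a ks k W Ws)
  {
    case 1
    have "row (W * B) i \<in> carrier_vec n" if "B \<in> linear_parts Ws A" for i B
    proof -
      have "dim_col B = n" using "2.IH"(2) 2 1 that by auto
      then show ?thesis using row_carrier[of "W * B" i] by simp
    qed
    then show ?case using 2 1 by auto
  next
    case 2
    show ?case using "2.IH"(2) 2 by (auto intro!: mult_carrier_mat)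
  }
qed auto

lemma linear_part_mem:
  assumes "layers ks k Ws"
  shows "linear_part Ws A x \<in> linear_parts Ws A"
  using assms
proof (induction ks k Ws rule: layers.induct)
  case (1 k)
  have "pos (A *\<^sub>v x) \<subseteq> {..<dim_row A}" by (auto simp: pos_def)
  then show ?case by (simp add: linear_part_Nil)
next
  case (2 a ks k W Ws)
  have "pos (W *\<^sub>v hidden Ws A x) \<subseteq> {..<dim_row W}" by (auto simp: pos_def)
  then have "(pos (W *\<^sub>v hidden Ws A x), linear_part Ws A x) \<in> Pow {..<dim_row W} \<times> linear_parts Ws A"
    using 2 by simp
  then show ?case unfolding linear_parts.simps linear_part_Cons by (rule rev_image_eqI) simp
qed simp_all

text \<open>At such a point no pre-activation vanishes or changes its sign along the axis-parallel
  segments of half-length \<open>\<epsilon>\<close>, unless it vanishes identically.\<close>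

definition clear_of :: "nat \<Rightarrow> real \<Rightarrow> real Matrix.vec set \<Rightarrow> real Matrix.vec \<Rightarrow> bool" where
  "clear_of n \<epsilon> L x \<longleftrightarrow> (\<forall>l\<in>L. l \<noteq> 0\<^sub>v n \<longrightarrow> (\<forall>j<n. \<epsilon> * \<bar>l $ j\<bar> < \<bar>l \<bullet> x\<bar>))"

section \<open>Behaviour near a point that is clear of the hyperplanes\<close>

lemma scalar_prod_shift:
  fixes l x :: "real Matrix.vec"
  assumes "l \<in> carrier_vec n" "x \<in> carrier_vec n" "j < n"
  shows "l \<bullet> (x + t \<cdot>\<^sub>v unit_vec n j) = l \<bullet> x + t * l $ j"
  using assms by (simp add: scalar_prod_add_distrib[of _ n])

text \<open>Moving by \<open>t\<close> along axis \<open>j\<close> changes the scalar product by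
  \<open>t * l $ j\<close>, which is smaller in absolute value than \<open>l \<bullet> x\<close>
  itself. For the zero vector both sides are false.\<close>

lemma clear_of_sign:
  assumes "clear_of n \<epsilon> L x" "l \<in> L" "l \<in> carrier_vec n" "x \<in> carrier_vec n" "j < n" "\<bar>t\<bar> \<le> \<epsilon>"
  shows "0 < l \<bullet> (x + t \<cdot>\<^sub>v unit_vec n j) \<longleftrightarrow> 0 < l \<bullet> x"
proof (cases "l = 0\<^sub>v n")
  case False
  then have "\<epsilon> * \<bar>l $ j\<bar> < \<bar>l \<bullet> x\<bar>" using assms by (auto simp: clear_of_def)
  moreover have "\<bar>t * l $ j\<bar> \<le> \<epsilon> * \<bar>l $ j\<bar>"
    using assms(6) by (simp add: abs_mult mult_right_mono)
  ultimately show ?thesis using scalar_prod_shift[OF assms(3-5), of t] by linarith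
qed (use assms in simp)

text \<open>Induction from the input outwards: as long as the inner patterns agree, both points see
  the same linear map \<open>?B\<close> below \<open>W\<close>, so the next pre-activations are
  values of the same functionals, and these belong to \<open>preactivations\<close>.\<close>

lemma patterns_locally_constant:
  assumes "layers ks k Ws" "A \<in> carrier_mat k n" "x \<in> carrier_vec n" "j < n" "\<bar>t\<bar> \<le> \<epsilon>"
    "clear_of n \<epsilon> (preactivations Ws A) x"
  shows "pos (A *\<^sub>v (x + t \<cdot>\<^sub>v unit_vec n j)) = pos (A *\<^sub>v x) \<and>
    patterns Ws A (x + t \<cdot>\<^sub>v unit_vec n j) = patterns Ws A x"
  using assms
proof (induction ks k Ws rule: layers.induct)
  case (1 k)
  have "0 < row A i \<bullet> (x + t \<cdot>\<^sub>v unit_vec n j) \<longleftrightarrow> 0 < row A i \<bullet> x" if "i < k" for i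
    using 1 that by (intro clear_of_sign[of n \<epsilon> "preactivations [] A"]) auto
  then show ?case using 1 by (auto simp: pos_def)
next
  case (2 a ks k W Ws)
  let ?y = "x + t \<cdot>\<^sub>v unit_vec n j" and ?B = "linear_part Ws A x"
  have L: "layers ks k Ws" and W: "W \<in> carrier_mat a (hd (ks @ [k]))" using 2 by simp_all
  have y: "?y \<in> carrier_vec n" using 2 by simp
  have "clear_of n \<epsilon> (preactivations Ws A) x"
    using 2 by (auto simp: clear_of_def)
  then have IH: "pos (A *\<^sub>v ?y) = pos (A *\<^sub>v x)" "patterns Ws A ?y = patterns Ws A x"
    using 2 L by auto
  then have B: "linear_part Ws A ?y = ?B" by (simp add: linear_part_def)
  have Bc: "?B \<in> carrier_mat (hd (ks @ [k])) n" using linear_part_carrier[OF L] 2 by simp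
  have pre: "W *\<^sub>v hidden Ws A z = (W * ?B) *\<^sub>v z"
    if "z \<in> carrier_vec n" "linear_part Ws A z = ?B" for z
    using hidden_eq_linear_part[OF L "2.prems"(2) that(1)] that assoc_mult_mat_vec[OF W Bc that(1)]
    by simp
  have "0 < row (W * ?B) i \<bullet> ?y \<longleftrightarrow> 0 < row (W * ?B) i \<bullet> x" if i: "i < a" for i
  proof (rule clear_of_sign[of n \<epsilon> "preactivations (W # Ws) A"])
    have "(i, ?B) \<in> {..<dim_row W} \<times> linear_parts Ws A"
      using linear_part_mem[OF L, of A x] i W by simp
    then have "row (W * ?B) i \<in> (\<lambda>(i, B). row (W * B) i) ` ({..<dim_row W} \<times> linear_parts Ws A)"
      by (rule rev_image_eqI) simp
    then show "row (W * ?B) i \<in> preactivations (W # Ws) A" by simp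
    show "row (W * ?B) i \<in> carrier_vec n" using W Bc i by auto
  qed (use 2 in auto)
  then have "pos ((W * ?B) *\<^sub>v ?y) = pos ((W * ?B) *\<^sub>v x)"
    using W by (auto simp: pos_def)
  then have "pos (W *\<^sub>v hidden Ws A ?y) = pos (W *\<^sub>v hidden Ws A x)"
    using pre[OF y B] pre[OF "2.prems"(3)] by simp
  then show ?case using IH by simp
qed simp_all

definition local_gradient ::
    "real Matrix.vec \<Rightarrow> real mat list \<Rightarrow> real mat \<Rightarrow> real Matrix.vec \<Rightarrow> real Matrix.vec" where
  "local_gradient w Ws A x = (linear_part Ws A x)\<^sup>T *\<^sub>v w"

lemma local_gradient_carrier:
  assumes "network_shape n k ks w Ws A"
  shows "local_gradient w Ws A x \<in> carrier_vec n"
proof -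
  have *: "A \<in> carrier_mat k n" "layers ks k Ws" "w \<in> carrier_vec (hd (ks @ [k]))"
    using assms by (auto simp: network_shape_iff)
  have "(linear_part Ws A x)\<^sup>T \<in> carrier_mat n (hd (ks @ [k]))"
    using linear_part_carrier[OF *(2,1)] by simp
  then show ?thesis unfolding local_gradient_def using *(3) by (rule mult_mat_vec_carrier)
qed

lemma network_eq_linear:
  assumes "network_shape n k ks w Ws A" "y \<in> carrier_vec n" "linear_part Ws A y = linear_part Ws A x"
  shows "network w Ws A y = local_gradient w Ws A x \<bullet> y"
proof -
  have *: "A \<in> carrier_mat k n" "layers ks k Ws" "w \<in> carrier_vec (hd (ks @ [k]))"
    using assms by (auto simp: network_shape_iff)
  let ?B = "linear_part Ws A x"
  have B: "?B \<in> carrier_mat (hd (ks @ [k])) n" using linear_part_carrier[OF *(2,1)] .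
  have "network w Ws A y = w \<bullet> (?B *\<^sub>v y)"
    using hidden_eq_linear_part[OF *(2,1) assms(2)] assms(3) by (simp add: network_def)
  also have "\<dots> = (?B\<^sup>T *\<^sub>v w) \<bullet> y"
    using transpose_vec_mult_scalar[OF B assms(2) *(3)] by simp
  finally show ?thesis by (simp add: local_gradient_def)
qed

lemma network_shift:
  assumes shape: "network_shape n k ks w Ws A" and x: "x \<in> carrier_vec n" and j: "j < n"
    and t: "\<bar>t\<bar> \<le> \<epsilon>" and clear: "clear_of n \<epsilon> (preactivations Ws A) x"
  shows "network w Ws A (x + t \<cdot>\<^sub>v unit_vec n j) = network w Ws A x + t * local_gradient w Ws A x $ j"
proof -
  have *: "A \<in> carrier_mat k n" "layers ks k Ws" using shape by (auto simp: network_shape_iff)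
  have "linear_part Ws A (x + t \<cdot>\<^sub>v unit_vec n j) = linear_part Ws A x"
    using patterns_locally_constant[OF *(2,1) x j t clear] by (simp add: linear_part_def)
  then show ?thesis
    using network_eq_linear[OF shape, of "x + t \<cdot>\<^sub>v unit_vec n j" x] network_eq_linear[OF shape x refl]
      scalar_prod_shift[OF local_gradient_carrier[OF shape] x j] x by simp
qed

lemma quotients_eq_local_gradient:
  assumes "network_shape n k ks w Ws A" "x \<in> carrier_vec n" "0 < \<epsilon>"
    "clear_of n \<epsilon> (preactivations Ws A) x"
  shows "quotients \<epsilon> n (network w Ws A) x = local_gradient w Ws A x"
proof (rule eq_vecI)
  have d: "dim_vec (local_gradient w Ws A x) = n" using local_gradient_carrier[OF assms(1)] by auto
  fix j assume "j < dim_vec (local_gradient w Ws A x)"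
  then show "quotients \<epsilon> n (network w Ws A) x $ j = local_gradient w Ws A x $ j"
    using network_shift[OF assms(1,2) _ _ assms(4), of j \<epsilon>] assms(3) d by (simp add: quotients_def)
qed (use carrier_vecD[OF local_gradient_carrier[OF assms(1)]] in \<open>simp add: quotients_def\<close>)

lemma is_gradient_local_gradient:
  assumes "network_shape n k ks w Ws A" "x \<in> carrier_vec n" "0 < \<epsilon>"
    "clear_of n \<epsilon> (preactivations Ws A) x"
  shows "is_gradient n (network w Ws A) x (local_gradient w Ws A x)"
  unfolding is_gradient_def
proof (intro conjI allI impI)
  fix j assume j: "j < n"
  let ?z = "local_gradient w Ws A x $ j"
  have "((\<lambda>t. network w Ws A x + t * ?z) has_real_derivative ?z) (at 0)"
    by (auto intro!: derivative_eq_intros)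
  then show "((\<lambda>t. network w Ws A (x + t \<cdot>\<^sub>v unit_vec n j)) has_real_derivative ?z) (at 0)"
  proof (rule has_field_derivative_transform_within[of _ _ _ _ \<epsilon>])
    fix t :: real assume "dist t 0 < \<epsilon>"
    then show "network w Ws A x + t * ?z = network w Ws A (x + t \<cdot>\<^sub>v unit_vec n j)"
      using network_shift[OF assms(1,2) j _ assms(4), of t] by simp
  qed (use assms in auto)
qed (use assms local_gradient_carrier in auto)

text \<open>The mask of the first layer is moved from the rows of \<open>A\<close> to the
  coefficient vector; inside the mask stands the vector of Assumption 2 for the realised
  patterns.\<close>

definition coefficients ::
    "real Matrix.vec \<Rightarrow> real mat list \<Rightarrow> real mat \<Rightarrow> real Matrix.vec \<Rightarrow> real Matrix.vec" where
  "coefficients w Ws A x = Matrix.vec (dim_row A) (\<lambda>i. if i \<in> pos (A *\<^sub>v x)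
     then (mat_of_row w * mask_prod Ws (patterns Ws A x) (1\<^sub>m (dim_row A))) $$ (0, i) else 0)"

lemma local_gradient_eq_coefficients:
  assumes "network_shape n k ks w Ws A"
  shows "local_gradient w Ws A x = A\<^sup>T *\<^sub>v coefficients w Ws A x"
proof -
  have *: "A \<in> carrier_mat k n" "layers ks k Ws" "w \<in> carrier_vec (hd (ks @ [k]))"
    using assms by (auto simp: network_shape_iff)
  define P where "P = mask_prod Ws (patterns Ws A x) (1\<^sub>m k)"
  define S where "S = pos (A *\<^sub>v x)"
  have P: "P \<in> carrier_mat (hd (ks @ [k])) k"
    unfolding P_def by (rule mask_prod_carrier[OF *(2) length_patterns[OF *(2)]]) simp
  have S: "mask_rows S A \<in> carrier_mat k n" using * by simp
  have lp: "linear_part Ws A x = P * mask_rows S A"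
    unfolding linear_part_def P_def S_def using * length_patterns[OF *(2)]
    by (intro mask_prod_mult) auto
  have PS: "(P * mask_rows S A)\<^sup>T = (mask_rows S A)\<^sup>T * P\<^sup>T"
    using P S by (rule transpose_mult)
  have ST: "(mask_rows S A)\<^sup>T \<in> carrier_mat n k" and PT: "P\<^sup>T \<in> carrier_mat k (hd (ks @ [k]))"
    using S P by simp_all
  have "local_gradient w Ws A x = (mask_rows S A)\<^sup>T *\<^sub>v (P\<^sup>T *\<^sub>v w)"
    unfolding local_gradient_def lp PS by (rule assoc_mult_mat_vec[OF ST PT *(3)])
  also have "\<dots> = A\<^sup>T *\<^sub>v coefficients w Ws A x"
  proof (rule eq_vecI)
    fix j assume "j < dim_vec (A\<^sup>T *\<^sub>v coefficients w Ws A x)"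
    then have j: "j < n" using * by simp
    define u where "u = P\<^sup>T *\<^sub>v w"
    have u: "u \<in> carrier_vec k" unfolding u_def using PT *(3) by (rule mult_mat_vec_carrier)
    have v: "u $ i = (mat_of_row w * P) $$ (0, i)" if "i < k" for i
      using that P *(3) by (simp add: u_def mat_of_row_def scalar_prod_def mult.commute)
    have cu: "coefficients w Ws A x $ i = (if i \<in> S then u $ i else 0)" if "i < k" for i
      using *(1) v[OF that] that unfolding coefficients_def P_def S_def
      by (simp del: index_mult_mat)
    have c: "dim_vec (coefficients w Ws A x) = k" using *(1) by (simp add: coefficients_def)
    have "((mask_rows S A)\<^sup>T *\<^sub>v u) $ j = (\<Sum>i<k. mask_rows S A $$ (i, j) * u $ i)"
      using *(1) u j by (simp add: scalar_prod_def lessThan_atLeast0)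
    also have "\<dots> = (\<Sum>i<k. A $$ (i, j) * coefficients w Ws A x $ i)"
      using *(1) j by (intro sum.cong) (auto simp: mask_rows_index cu)
    also have "\<dots> = (A\<^sup>T *\<^sub>v coefficients w Ws A x) $ j"
      using *(1) j c by (simp add: scalar_prod_def lessThan_atLeast0)
    finally show "((mask_rows S A)\<^sup>T *\<^sub>v (P\<^sup>T *\<^sub>v w)) $ j = (A\<^sup>T *\<^sub>v coefficients w Ws A x) $ j"
      unfolding u_def .
  qed (use * S in auto)
  finally show ?thesis .
qed

text \<open>Without biases a zero vector stays zero through all later layers, and a layer with empty
  pattern outputs zero; so a non-zero output excludes empty patterns everywhere.\<close>

lemma patterns_nonempty:
  assumes "layers ks k Ws" "A \<in> carrier_mat k n" "x \<in> carrier_vec n"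
    "hidden Ws A x \<noteq> 0\<^sub>v (hd (ks @ [k]))"
  shows "\<forall>i<length ks. patterns Ws A x ! i \<noteq> {} \<and> patterns Ws A x ! i \<subseteq> {..<ks ! i}"
  using assms
proof (induction ks k Ws rule: layers.induct)
  case (2 a ks k W Ws)
  let ?h = "hidden Ws A x"
  have L: "layers ks k Ws" and W: "W \<in> carrier_mat a (hd (ks @ [k]))" using 2 by simp_all
  have h: "?h \<in> carrier_vec (hd (ks @ [k]))" using hidden_carrier[OF L] 2 by simp
  have ne: "pos (W *\<^sub>v ?h) \<noteq> {}"
  proof
    assume "pos (W *\<^sub>v ?h) = {}"
    then have "\<And>i. i < a \<Longrightarrow> relu (W *\<^sub>v ?h) $ i = 0"
      using W by (auto simp: pos_def max_def)
    then have "relu (W *\<^sub>v ?h) = 0\<^sub>v a" using W by (intro eq_vecI) auto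
    then show False using 2 by simp
  qed
  have "?h \<noteq> 0\<^sub>v (hd (ks @ [k]))"
  proof
    assume "?h = 0\<^sub>v (hd (ks @ [k]))"
    then have "W *\<^sub>v ?h = 0\<^sub>v a" using W by auto
    then show False using ne by (auto simp: pos_def)
  qed
  then have "\<forall>i<length ks. patterns Ws A x ! i \<noteq> {} \<and> patterns Ws A x ! i \<subseteq> {..<ks ! i}"
    using 2 L by simp
  moreover have "pos (W *\<^sub>v ?h) \<subseteq> {..<a}" using W by (auto simp: pos_def)
  ultimately show ?case using ne by (simp add: All_less_Suc2)
qed simp_all

text \<open>A non-zero value of the network makes all patterns non-empty, which is what Assumption 2
  asks of the masks; so no coefficient inside the first-layer mask cancels to zero.\<close>

lemma support_coefficients:
  assumes shape: "network_shape n k ks w Ws A" and a2: "assumption2 n k ks \<gamma> w Ws A"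
    and x: "x \<in> carrier_vec n" "network w Ws A x \<noteq> 0"
  shows "support (coefficients w Ws A x) = pos (A *\<^sub>v x)"
proof -
  have *: "A \<in> carrier_mat k n" "layers ks k Ws" "w \<in> carrier_vec (hd (ks @ [k]))"
    using shape by (auto simp: network_shape_iff)
  have "hidden Ws A x \<noteq> 0\<^sub>v (hd (ks @ [k]))"
    using x(2) *(3) by (auto simp: network_def)
  then have "\<forall>i<length ks. patterns Ws A x ! i \<noteq> {} \<and> patterns Ws A x ! i \<subseteq> {..<ks ! i}"
    by (rule patterns_nonempty[OF *(2,1) x(1)])
  then have "\<forall>j<k. (mat_of_row w * mask_prod Ws (patterns Ws A x) (1\<^sub>m k)) $$ (0, j) \<noteq> 0"
    using a2 length_patterns[OF *(2)] unfolding assumption2_def by blast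
  moreover have "dim_row A = k" using *(1) by simp
  ultimately have "i < k \<Longrightarrow> coefficients w Ws A x $ i \<noteq> 0 \<longleftrightarrow> i \<in> pos (A *\<^sub>v x)" for i
    unfolding coefficients_def by simp
  moreover have "dim_vec (coefficients w Ws A x) = k" using *(1) by (simp add: coefficients_def)
  moreover have "pos (A *\<^sub>v x) \<subseteq> {..<k}" using *(1) by (auto simp: pos_def)
  ultimately show ?thesis unfolding support_def by blast
qed

lemma sign_pattern_relu:
  "sign_pattern (relu y) = Matrix.vec (dim_vec y) (\<lambda>i. if i \<in> pos y then 1 else 0)"
  by (rule eq_vecI) (auto simp: sign_pattern_def relu_def pos_def)


section \<open>Measurability of the success event\<close>

text \<open>Measurability coordinate by coordinate, with a dimension that is the same at every
  point, avoids choosing a sigma-algebra on \<open>Matrix.vec\<close>.\<close>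

definition measurable_vec :: "'w measure \<Rightarrow> nat \<Rightarrow> ('w \<Rightarrow> real Matrix.vec) \<Rightarrow> bool" where
  "measurable_vec N m y \<longleftrightarrow>
     (\<forall>\<omega>. y \<omega> \<in> carrier_vec m) \<and> (\<forall>i<m. (\<lambda>\<omega>. y \<omega> $ i) \<in> borel_measurable N)"

lemma measurable_vecD:
  assumes "measurable_vec N m y"
  shows "y \<omega> \<in> carrier_vec m" "dim_vec (y \<omega>) = m"
    "i < m \<Longrightarrow> (\<lambda>\<omega>. y \<omega> $ i) \<in> borel_measurable N"
  using assms by (auto simp: measurable_vec_def)

lemma measurable_vec_mult:
  assumes W: "W \<in> carrier_mat a b" and y: "measurable_vec N b y"
  shows "measurable_vec N a (\<lambda>\<omega>. W *\<^sub>v y \<omega>)"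
  unfolding measurable_vec_def
proof (intro conjI allI impI)
  show "W *\<^sub>v y \<omega> \<in> carrier_vec a" for \<omega>
    using W measurable_vecD(1)[OF y] by (rule mult_mat_vec_carrier)
  fix i assume i: "i < a"
  have "(W *\<^sub>v y \<omega>) $ i = (\<Sum>j<b. W $$ (i, j) * y \<omega> $ j)" for \<omega>
    using i W measurable_vecD(2)[OF y] by (simp add: scalar_prod_def lessThan_atLeast0)
  then show "(\<lambda>\<omega>. (W *\<^sub>v y \<omega>) $ i) \<in> borel_measurable N"
    using measurable_vecD(3)[OF y] by (simp add: borel_measurable_sum borel_measurable_times)
qed

lemma measurable_vec_relu:
  assumes y: "measurable_vec N m y"
  shows "measurable_vec N m (\<lambda>\<omega>. relu (y \<omega>))"
proof -
  have eq: "(\<lambda>\<omega>. relu (y \<omega>) $ i) = (\<lambda>\<omega>. max 0 (y \<omega> $ i))" if "i < m" for i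
    using measurable_vecD(2)[OF y] that by (intro ext) simp
  have "(\<lambda>\<omega>. relu (y \<omega>) $ i) \<in> borel_measurable N" if "i < m" for i
    unfolding eq[OF that] by (intro borel_measurable_max borel_measurable_const measurable_vecD(3)[OF y that])
  then show ?thesis
    using measurable_vecD(1)[OF y] unfolding measurable_vec_def by simp
qed

lemma measurable_scalar_prod:
  fixes y z :: "'w \<Rightarrow> real Matrix.vec"
  assumes y: "measurable_vec N m y" and z: "measurable_vec N m z"
  shows "(\<lambda>\<omega>. y \<omega> \<bullet> z \<omega>) \<in> borel_measurable N"
proof -
  have "y \<omega> \<bullet> z \<omega> = (\<Sum>j<m. y \<omega> $ j * z \<omega> $ j)" for \<omega>
    using measurable_vecD(2)[OF z] by (simp add: scalar_prod_def lessThan_atLeast0)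
  then show ?thesis
    using measurable_vecD(3)[OF y] measurable_vecD(3)[OF z]
    by (simp add: borel_measurable_sum borel_measurable_times)
qed

lemma measurable_vec_const: "c \<in> carrier_vec m \<Longrightarrow> measurable_vec N m (\<lambda>_. c)"
  by (simp add: measurable_vec_def)

lemma measurable_vec_shift:
  assumes y: "measurable_vec N n y" and "j < n"
  shows "measurable_vec N n (\<lambda>\<omega>. y \<omega> + t \<cdot>\<^sub>v unit_vec n j)"
  using measurable_vecD[OF y] unfolding measurable_vec_def
  by (simp add: borel_measurable_add)

lemma measurable_vec_hidden:
  assumes "layers ks k Ws" "A \<in> carrier_mat k n" "measurable_vec N n x"
  shows "measurable_vec N (hd (ks @ [k])) (\<lambda>\<omega>. hidden Ws A (x \<omega>))"
  using assms
proof (induction ks k Ws rule: layers.induct)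
  case (1 k)
  then show ?case by (simp add: measurable_vec_relu measurable_vec_mult)
next
  case (2 a ks k W Ws)
  then have "measurable_vec N a (\<lambda>\<omega>. relu (W *\<^sub>v hidden Ws A (x \<omega>)))"
    by (intro measurable_vec_relu measurable_vec_mult[of W a "hd (ks @ [k])"]) simp_all
  then show ?case by simp
qed simp_all

lemma measurable_network:
  assumes "network_shape n k ks w Ws A" "measurable_vec N n x"
  shows "(\<lambda>\<omega>. network w Ws A (x \<omega>)) \<in> borel_measurable N"
proof -
  have "A \<in> carrier_mat k n" "layers ks k Ws" "w \<in> carrier_vec (hd (ks @ [k]))"
    using assms(1) by (auto simp: network_shape_iff)
  then show ?thesis
    unfolding network_def
    by (intro measurable_scalar_prod[OF measurable_vec_const measurable_vec_hidden[OF _ _ assms(2)]])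
qed

lemma measurable_vec_quotients:
  assumes "network_shape n k ks w Ws A" and x: "measurable_vec N n x"
  shows "measurable_vec N n (\<lambda>\<omega>. quotients \<epsilon> n (network w Ws A) (x \<omega>))"
  unfolding measurable_vec_def quotients_def
  using measurable_network[OF assms(1) measurable_vec_shift[OF x]] measurable_network[OF assms]
  by (simp add: borel_measurable_divide borel_measurable_diff)

text \<open>Serves to show that the network is continuous along axis-parallel lines, so that
  derivatives can be tested at rational steps.\<close>

definition continuous_vec :: "nat \<Rightarrow> (real \<Rightarrow> real Matrix.vec) \<Rightarrow> bool" where
  "continuous_vec m y \<longleftrightarrow>
     (\<forall>t. y t \<in> carrier_vec m) \<and> (\<forall>i<m. continuous_on UNIV (\<lambda>t. y t $ i))"

lemma continuous_vec_mult:
  assumes W: "W \<in> carrier_mat a b" and y: "continuous_vec b y"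
  shows "continuous_vec a (\<lambda>t. W *\<^sub>v y t)"
  unfolding continuous_vec_def
proof (intro conjI allI impI)
  have d: "y t \<in> carrier_vec b" for t using y by (simp add: continuous_vec_def)
  show "W *\<^sub>v y t \<in> carrier_vec a" for t
    using W d by (rule mult_mat_vec_carrier)
  fix i assume i: "i < a"
  have "(W *\<^sub>v y t) $ i = (\<Sum>j<b. W $$ (i, j) * y t $ j)" for t
    using i W carrier_vecD[OF d[of t]] by (simp add: scalar_prod_def lessThan_atLeast0)
  then show "continuous_on UNIV (\<lambda>t. (W *\<^sub>v y t) $ i)"
    using y unfolding continuous_vec_def by (simp, intro continuous_intros) simp
qed

lemma continuous_vec_relu:
  assumes y: "continuous_vec m y"
  shows "continuous_vec m (\<lambda>t. relu (y t))"
proof -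
  have "dim_vec (y t) = m" for t using y carrier_vecD by (simp add: continuous_vec_def)
  then have "relu (y t) $ i = max 0 (y t $ i)" if "i < m" for i t using that by simp
  then show ?thesis
    using y unfolding continuous_vec_def by (simp add: continuous_on_max)
qed

lemma continuous_vec_hidden:
  assumes "layers ks k Ws" "A \<in> carrier_mat k n" "continuous_vec n x"
  shows "continuous_vec (hd (ks @ [k])) (\<lambda>t. hidden Ws A (x t))"
  using assms
proof (induction ks k Ws rule: layers.induct)
  case (1 k)
  then show ?case by (simp add: continuous_vec_relu continuous_vec_mult)
next
  case (2 a ks k W Ws)
  then have "continuous_vec a (\<lambda>t. relu (W *\<^sub>v hidden Ws A (x t)))"
    by (intro continuous_vec_relu continuous_vec_mult[of W a "hd (ks @ [k])"]) simp_all
  then show ?case by simp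
qed simp_all

lemma continuous_network_line:
  assumes "network_shape n k ks w Ws A" "x \<in> carrier_vec n" "j < n"
  shows "continuous_on UNIV (\<lambda>t. network w Ws A (x + t \<cdot>\<^sub>v unit_vec n j))"
proof -
  have *: "A \<in> carrier_mat k n" "layers ks k Ws" "w \<in> carrier_vec (hd (ks @ [k]))"
    using assms(1) by (auto simp: network_shape_iff)
  let ?m = "hd (ks @ [k])" and ?h = "\<lambda>t. hidden Ws A (x + t \<cdot>\<^sub>v unit_vec n j)"
  have "continuous_vec n (\<lambda>t. x + t \<cdot>\<^sub>v unit_vec n j)"
    using assms by (simp add: continuous_vec_def continuous_on_add continuous_on_mult)
  then have h: "continuous_vec ?m ?h" by (rule continuous_vec_hidden[OF *(2,1)])
  have d: "?h t \<in> carrier_vec ?m" for t using h by (simp add: continuous_vec_def)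
  have "network w Ws A (x + t \<cdot>\<^sub>v unit_vec n j) = (\<Sum>i<?m. w $ i * ?h t $ i)" for t
    using carrier_vecD[OF d[of t]] by (simp add: network_def scalar_prod_def lessThan_atLeast0)
  then show ?thesis
    using h unfolding continuous_vec_def by (simp, intro continuous_intros) simp
qed

text \<open>Replaces the uncountably many step widths by countably many, so that having derivative
  \<open>d\<close> becomes a measurable event. The estimate is multiplied out, which makes it
  trivial at step 0, and non-strict, so that it passes from rational steps to their limits.\<close>

lemma has_real_derivative_iff_rational:
  fixes F :: "real \<Rightarrow> real"
  assumes cont: "continuous_on UNIV F"
  shows "(F has_real_derivative d) (at 0) \<longleftrightarrow>
    (\<forall>m::nat. \<exists>N::nat. \<forall>q::rat. \<bar>real_of_rat q\<bar> < 1 / real (Suc N) \<longrightarrow>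
       \<bar>F (real_of_rat q) - F 0 - d * real_of_rat q\<bar> \<le> \<bar>real_of_rat q\<bar> / real (Suc m))"
proof
  assume "(F has_real_derivative d) (at 0)"
  then have lim: "(\<lambda>h. (F h - F 0) / h) \<midarrow>0\<rightarrow> d" by (simp add: DERIV_def)
  show "\<forall>m::nat. \<exists>N::nat. \<forall>q::rat. \<bar>real_of_rat q\<bar> < 1 / real (Suc N) \<longrightarrow>
       \<bar>F (real_of_rat q) - F 0 - d * real_of_rat q\<bar> \<le> \<bar>real_of_rat q\<bar> / real (Suc m)"
  proof
    fix m :: nat
    obtain s where s: "s > 0" "\<And>h. h \<noteq> 0 \<Longrightarrow> \<bar>h\<bar> < s \<Longrightarrow> \<bar>(F h - F 0) / h - d\<bar> < 1 / real (Suc m)"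
      using LIM_D[OF lim, of "1 / real (Suc m)"] by auto
    obtain N where N: "1 / real (Suc N) < s"
      using reals_Archimedean[OF s(1)] by (auto simp: inverse_eq_divide)
    have "\<bar>F h - F 0 - d * h\<bar> \<le> \<bar>h\<bar> / real (Suc m)" if h: "\<bar>h\<bar> < 1 / real (Suc N)" for h
    proof (cases "h = 0")
      case False
      have "\<bar>F h - F 0 - d * h\<bar> = \<bar>(F h - F 0) / h - d\<bar> * \<bar>h\<bar>"
        using False by (simp add: abs_mult[symmetric] field_simps)
      also have "\<dots> \<le> 1 / real (Suc m) * \<bar>h\<bar>"
        using s(2)[OF False] h N by (intro mult_right_mono) auto
      finally show ?thesis by simp
    qed simp
    then show "\<exists>N::nat. \<forall>q::rat. \<bar>real_of_rat q\<bar> < 1 / real (Suc N) \<longrightarrow>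
       \<bar>F (real_of_rat q) - F 0 - d * real_of_rat q\<bar> \<le> \<bar>real_of_rat q\<bar> / real (Suc m)" by blast
  qed
next
  assume R: "\<forall>m::nat. \<exists>N::nat. \<forall>q::rat. \<bar>real_of_rat q\<bar> < 1 / real (Suc N) \<longrightarrow>
       \<bar>F (real_of_rat q) - F 0 - d * real_of_rat q\<bar> \<le> \<bar>real_of_rat q\<bar> / real (Suc m)"
  have "(\<lambda>h. (F h - F 0) / h) \<midarrow>0\<rightarrow> d"
  proof (rule LIM_I)
    fix r :: real assume "0 < r"
    then obtain m where m: "1 / real (Suc m) < r"
      using reals_Archimedean by (auto simp: inverse_eq_divide)
    obtain N where N: "\<And>q::rat. \<bar>real_of_rat q\<bar> < 1 / real (Suc N) \<Longrightarrow>
        \<bar>F (real_of_rat q) - F 0 - d * real_of_rat q\<bar> \<le> \<bar>real_of_rat q\<bar> / real (Suc m)"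
      using R by blast
    \<comment> \<open>The slack of the estimate, continuous in \<open>h\<close>: a negative value
      would persist on an open interval, hence at a rational step.\<close>
    define G where "G h = \<bar>h\<bar> / real (Suc m) - \<bar>F h - F 0 - d * h\<bar>" for h
    have G: "0 \<le> G h" if h: "\<bar>h\<bar> < 1 / real (Suc N)" for h
    proof (rule ccontr)
      assume "\<not> 0 \<le> G h"
      moreover have "continuous_on UNIV G"
        unfolding G_def by (intro continuous_intros cont) auto
      then have "open (G -` {..<0})"
        by (intro open_vimage) auto
      ultimately have "open (G -` {..<0} \<inter> {- 1 / real (Suc N)<..<1 / real (Suc N)})"
        "h \<in> G -` {..<0} \<inter> {- 1 / real (Suc N)<..<1 / real (Suc N)}"
        using h by (auto simp: abs_less_iff)
      then obtain e where e: "e > 0" "ball h e \<subseteq> G -` {..<0} \<inter> {- 1 / real (Suc N)<..<1 / real (Suc N)}"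
        by (meson open_contains_ball)
      obtain x where x: "x \<in> \<rat>" "h < x" "x < h + e"
        using Rats_dense_in_real[of h "h + e"] e(1) by auto
      then obtain q where q: "x = real_of_rat q" by (auto elim: Rats_cases)
      have "x \<in> ball h e" using x by (simp add: dist_real_def)
      then have "G x < 0" "\<bar>x\<bar> < 1 / real (Suc N)" using e(2) by (auto simp: abs_less_iff)
      then show False using N[of q] q by (simp add: G_def)
    qed
    have "\<bar>(F h - F 0) / h - d\<bar> < r" if h: "h \<noteq> 0" "\<bar>h\<bar> < 1 / real (Suc N)" for h
    proof -
      have "\<bar>(F h - F 0) / h - d\<bar> * \<bar>h\<bar> = \<bar>F h - F 0 - d * h\<bar>"
        using h by (simp add: abs_mult[symmetric] field_simps)
      also have "\<dots> \<le> 1 / real (Suc m) * \<bar>h\<bar>" using G[OF h(2)] by (simp add: G_def)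
      finally have "\<bar>(F h - F 0) / h - d\<bar> \<le> 1 / real (Suc m)"
        using h(1) by (simp only: mult_le_cancel_right)
      then show ?thesis using m by linarith
    qed
    then show "\<exists>s>0. \<forall>x. x \<noteq> 0 \<and> norm (x - 0) < s \<longrightarrow> norm ((F x - F 0) / x - d) < r"
      by (intro exI[of _ "1 / real (Suc N)"]) auto
  qed
  then show "(F has_real_derivative d) (at 0)" by (simp add: DERIV_def)
qed

section \<open>Measurability of the three conditions that make up success\<close>

lemma measurable_is_gradient:
  assumes shape: "network_shape n k ks w Ws A"
    and x: "measurable_vec N n x" and z: "measurable_vec N n z"
  shows "Measurable.pred N (\<lambda>\<omega>. is_gradient n (network w Ws A) (x \<omega>) (z \<omega>))"
proof -
  let ?F = "\<lambda>j t \<omega>. network w Ws A (x \<omega> + t \<cdot>\<^sub>v unit_vec n j)"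
  have F: "(\<lambda>\<omega>. ?F j t \<omega>) \<in> borel_measurable N" if "j < n" for j t
    by (intro measurable_network[OF shape] measurable_vec_shift[OF x that])
  have zj: "(\<lambda>\<omega>. z \<omega> $ j) \<in> borel_measurable N" if "j < n" for j
    using measurable_vecD(3)[OF z that] .
  have p: "Measurable.pred N (\<lambda>\<omega>. \<bar>real_of_rat q\<bar> < 1 / real (Suc i) \<longrightarrow>
       \<bar>?F j (real_of_rat q) \<omega> - ?F j 0 \<omega> - z \<omega> $ j * real_of_rat q\<bar> \<le> \<bar>real_of_rat q\<bar> / real (Suc m))"
    if "j < n" for j q i m
    using F[OF that] zj[OF that] by measurable
  have all: "Measurable.pred N (\<lambda>\<omega>. \<forall>j\<in>{..<n}. \<forall>m::nat. \<exists>i::nat. \<forall>q::rat. \<bar>real_of_rat q\<bar> < 1 / real (Suc i) \<longrightarrow>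
       \<bar>?F j (real_of_rat q) \<omega> - ?F j 0 \<omega> - z \<omega> $ j * real_of_rat q\<bar> \<le> \<bar>real_of_rat q\<bar> / real (Suc m))"
    by (intro pred_intros_countable pred_intros_finite finite_lessThan p) simp
  have iff: "is_gradient n (network w Ws A) (x \<omega>) (z \<omega>) \<longleftrightarrow>
    (\<forall>j\<in>{..<n}. \<forall>m::nat. \<exists>i::nat. \<forall>q::rat. \<bar>real_of_rat q\<bar> < 1 / real (Suc i) \<longrightarrow>
       \<bar>?F j (real_of_rat q) \<omega> - ?F j 0 \<omega> - z \<omega> $ j * real_of_rat q\<bar> \<le> \<bar>real_of_rat q\<bar> / real (Suc m))"
    for \<omega>
    unfolding is_gradient_def
    using measurable_vecD(1)[OF x, of \<omega>] measurable_vecD(1)[OF z, of \<omega>]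
      has_real_derivative_iff_rational[OF continuous_network_line[OF shape]]
    by (simp add: Ball_def)
  show ?thesis unfolding iff by (rule all)
qed

lemma measurable_row_space:
  assumes "A \<in> carrier_mat k n" "vec_space.rank k A = k" "measurable_vec N n z"
  shows "Measurable.pred N (\<lambda>\<omega>. z \<omega> \<in> vec_space.row_space n A)"
proof -
  obtain P where P: "P \<in> carrier_mat n n"
    "\<And>z. z \<in> carrier_vec n \<Longrightarrow> z \<in> vec_space.row_space n A \<longleftrightarrow> P *\<^sub>v z = z"
    using row_space_projection[OF assms(1,2)] by blast
  have Pz: "measurable_vec N n (\<lambda>\<omega>. P *\<^sub>v z \<omega>)" by (rule measurable_vec_mult[OF P(1) assms(3)])
  have "z \<omega> \<in> vec_space.row_space n A \<longleftrightarrow> (\<forall>i\<in>{..<n}. (P *\<^sub>v z \<omega>) $ i = z \<omega> $ i)" for \<omega>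
    using P(2)[OF measurable_vecD(1)[OF assms(3), of \<omega>]] measurable_vecD(2)[OF assms(3), of \<omega>]
      measurable_vecD(2)[OF Pz, of \<omega>] by (simp add: vec_eq_iff lessThan_def)
  moreover have "Measurable.pred N (\<lambda>\<omega>. (P *\<^sub>v z \<omega>) $ i = z \<omega> $ i)" if "i < n" for i
    using measurable_vecD(3)[OF Pz that] measurable_vecD(3)[OF assms(3) that] by measurable
  then have "Measurable.pred N (\<lambda>\<omega>. \<forall>i\<in>{..<n}. (P *\<^sub>v z \<omega>) $ i = z \<omega> $ i)"
    by (intro pred_intros_finite) auto
  ultimately show ?thesis by simp
qed

text \<open>By the Leibniz formula each Gram determinant is a polynomial in the scalar products of
  the \<open>z i\<close>, and \<open>rank_ge_iff_gram\<close> involves only finitely many of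
  them.\<close>

lemma measurable_rank_ge:
  fixes z :: "nat \<Rightarrow> 'w \<Rightarrow> real Matrix.vec"
  assumes z: "\<And>i. i < r \<Longrightarrow> measurable_vec N n (z i)"
  shows "Measurable.pred N (\<lambda>\<omega>. m \<le> vec_space.rank n (mat_of_cols n (map (\<lambda>i. z i \<omega>) [0..<r])))"
proof -
  let ?I = "{is. set is \<subseteq> {..<r} \<and> length is = m}"
  have fin: "finite ?I" by (rule finite_lists_length_eq) simp
  have det: "(\<lambda>\<omega>. det (gram_mat (map (\<lambda>i. z i \<omega>) is))) \<in> borel_measurable N" if "is \<in> ?I" for "is"
  proof -
    have len: "length is = m" and r: "\<And>a. a < m \<Longrightarrow> is ! a < r" using that by (auto simp: subset_eq)
    have G: "gram_mat (map (\<lambda>i. z i \<omega>) is) \<in> carrier_mat m m" for \<omega>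
      using len by (simp add: gram_mat_def)
    have "det (gram_mat (map (\<lambda>i. z i \<omega>) is)) = (\<Sum>p | p permutes {0..<m}.
        signof p * (\<Prod>a = 0..<m. z (is ! a) \<omega> \<bullet> z (is ! p a) \<omega>))" for \<omega>
      unfolding det_def'[OF G]
    proof (intro sum.cong refl arg_cong2[of _ _ _ _ "(*)"] prod.cong)
      fix p a assume "p \<in> {p. p permutes {0..<m}}" "a \<in> {0..<m}"
      then have "a < m" "p a < m" using permutes_in_image[of p "{0..<m}" a] by auto
      then show "gram_mat (map (\<lambda>i. z i \<omega>) is) $$ (a, p a) = z (is ! a) \<omega> \<bullet> z (is ! p a) \<omega>"
        using len by (simp add: gram_mat_def)
    qed
    moreover have "(\<lambda>\<omega>. \<Sum>p | p permutes {0..<m}.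
        signof p * (\<Prod>a = 0..<m. z (is ! a) \<omega> \<bullet> z (is ! p a) \<omega>) :: real) \<in> borel_measurable N"
    proof (intro borel_measurable_sum borel_measurable_times borel_measurable_const borel_measurable_prod)
      fix p a assume "p \<in> {p. p permutes {0..<m}}" "a \<in> {0..<m}"
      then have "a < m" "p a < m" using permutes_in_image[of p "{0..<m}" a] by auto
      then show "(\<lambda>\<omega>. z (is ! a) \<omega> \<bullet> z (is ! p a) \<omega>) \<in> borel_measurable N"
        using z r by (intro measurable_scalar_prod) auto
    qed
    ultimately show ?thesis by simp
  qed
  have iff: "m \<le> vec_space.rank n (mat_of_cols n (map (\<lambda>i. z i \<omega>) [0..<r])) \<longleftrightarrow>
      (\<exists>is\<in>?I. det (gram_mat (map (\<lambda>i. z i \<omega>) is)) \<noteq> 0)" for \<omega>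
  proof -
    have "set (map (\<lambda>i. z i \<omega>) [0..<r]) \<subseteq> carrier_vec n"
      using measurable_vecD(1)[OF z] by auto
    note eq = rank_ge_iff_gram[OF this, of m]
    have "map ((!) (map (\<lambda>i. z i \<omega>) [0..<r])) is = map (\<lambda>i. z i \<omega>) is" if "is \<in> ?I" for "is"
      using that by auto
    then have "gram_mat (map ((!) (map (\<lambda>i. z i \<omega>) [0..<r])) is) = gram_mat (map (\<lambda>i. z i \<omega>) is)"
      if "is \<in> ?I" for "is" using that by presburger
    moreover have "length (map (\<lambda>i. z i \<omega>) [0..<r]) = r" by simp
    ultimately show ?thesis unfolding eq by force
  qed
  have "Measurable.pred N (\<lambda>\<omega>. det (gram_mat (map (\<lambda>i. z i \<omega>) is)) \<noteq> 0)" if "is \<in> ?I" for "is"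
    using det[OF that] by measurable
  then have "Measurable.pred N (\<lambda>\<omega>. \<exists>is\<in>?I. det (gram_mat (map (\<lambda>i. z i \<omega>) is)) \<noteq> 0)"
    by (rule pred_intros_finite(4)[OF fin])
  then show ?thesis unfolding iff .
qed

text \<open>A span lies in the row space as soon as its generators do, and a dimension, being an
  integer, is at least \<open>k / 2\<close> exactly if it is at least
  \<open>(k + 1) div 2\<close>.\<close>

lemma success_iff:
  assumes gzs: "map (map_prod vec_of_list vec_of_list) gzs = map (\<lambda>i. (x i, z i)) [0..<r]"
    and z: "\<And>i. i < r \<Longrightarrow> z i \<in> carrier_vec n" and A: "A \<in> carrier_mat k n"
  shows "success n k A M gzs \<longleftrightarrow>
    (\<forall>i\<in>{..<r}. is_gradient n M (x i) (z i) \<and> z i \<in> vec_space.row_space n A) \<and>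
    (k + 1) div 2 \<le> vec_space.rank n (mat_of_cols n (map z [0..<r]))"
proof -
  interpret vec_space "TYPE(real)" n .
  have set: "(\<lambda>(g, z). (vec_of_list g, vec_of_list z)) ` set gzs = (\<lambda>i. (x i, z i)) ` {..<r}"
    using arg_cong[OF gzs, of set] by (simp add: map_prod_def lessThan_atLeast0)
  have mz: "map (vec_of_list \<circ> snd) gzs = map z [0..<r]"
    using arg_cong[OF gzs, of "map snd"] by (simp add: comp_def)
  have im: "(\<lambda>(g, z). vec_of_list z) ` set gzs = z ` {..<r}"
    using arg_cong[OF mz, of set] by (simp add: lessThan_atLeast0 comp_def case_prod_beta)
  have grad: "(\<forall>(g, z)\<in>set gzs. is_gradient n M (vec_of_list g) (vec_of_list z)) \<longleftrightarrow>
      (\<forall>i\<in>{..<r}. is_gradient n M (x i) (z i))"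
  proof -
    have "(\<forall>(g, z)\<in>set gzs. is_gradient n M (vec_of_list g) (vec_of_list z)) \<longleftrightarrow>
        (\<forall>p\<in>(\<lambda>(g, z). (vec_of_list g, vec_of_list z)) ` set gzs. is_gradient n M (fst p) (snd p))"
      by (auto simp: case_prod_beta)
    then show ?thesis unfolding set by simp
  qed
  have zc: "z ` {..<r} \<subseteq> carrier_vec n" using z by auto
  have sub: "returned_subspace n gzs \<subseteq> row_space A \<longleftrightarrow> (\<forall>i\<in>{..<r}. z i \<in> row_space A)"
  proof
    assume "returned_subspace n gzs \<subseteq> row_space A"
    then show "\<forall>i\<in>{..<r}. z i \<in> row_space A"
      using in_own_span[OF zc] unfolding returned_subspace_def im by auto
  next
    assume "\<forall>i\<in>{..<r}. z i \<in> row_space A"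
    then show "returned_subspace n gzs \<subseteq> row_space A"
      unfolding returned_subspace_def im row_space_def
      using A by (intro span_subsetI) (auto simp: rows_def)
  qed
  have "subspace_dim n (returned_subspace n gzs) = rank (mat_of_cols n (map z [0..<r]))"
    unfolding mz[symmetric]
  proof (rule subspace_dim_eq_rank)
    show "vec_of_list ` snd ` set gzs \<subseteq> carrier_vec n"
      using zc unfolding im[symmetric] by (auto simp: image_image case_prod_beta)
  qed
  then show ?thesis
    unfolding success_def grad sub by auto
qed

lemma measurable_success:
  assumes shape: "network_shape n k ks w Ws A" and rank: "vec_space.rank k A = k"
    and x: "\<And>i. i < r \<Longrightarrow> measurable_vec N n (x i)"
    and gzs: "\<And>\<omega>. map (map_prod vec_of_list vec_of_list) (gzs \<omega>) =
      map (\<lambda>i. (x i \<omega>, quotients \<epsilon> n (network w Ws A) (x i \<omega>))) [0..<r]"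
  shows "Measurable.pred N (\<lambda>\<omega>. success n k A (network w Ws A) (gzs \<omega>))"
proof -
  have A: "A \<in> carrier_mat k n" using shape by (simp add: network_shape_iff)
  let ?z = "\<lambda>i \<omega>. quotients \<epsilon> n (network w Ws A) (x i \<omega>)"
  have z: "measurable_vec N n (?z i)" if "i < r" for i
    by (rule measurable_vec_quotients[OF shape x[OF that]])
  have iff: "success n k A (network w Ws A) (gzs \<omega>) \<longleftrightarrow>
    (\<forall>i\<in>{..<r}. is_gradient n (network w Ws A) (x i \<omega>) (?z i \<omega>) \<and> ?z i \<omega> \<in> vec_space.row_space n A) \<and>
    (k + 1) div 2 \<le> vec_space.rank n (mat_of_cols n (map (\<lambda>i. ?z i \<omega>) [0..<r]))" for \<omega>
    by (rule success_iff[OF gzs _ A]) (simp add: quotients_def)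
  have 1: "Measurable.pred N (\<lambda>\<omega>. is_gradient n (network w Ws A) (x i \<omega>) (?z i \<omega>))" if "i < r" for i
    by (rule measurable_is_gradient[OF shape x[OF that] z[OF that]])
  have 2: "Measurable.pred N (\<lambda>\<omega>. ?z i \<omega> \<in> vec_space.row_space n A)" if "i < r" for i
    by (rule measurable_row_space[OF A rank z[OF that]])
  have 3: "Measurable.pred N (\<lambda>\<omega>. (k + 1) div 2 \<le> vec_space.rank n (mat_of_cols n (map (\<lambda>i. ?z i \<omega>) [0..<r])))"
    by (rule measurable_rank_ge[OF z])
  show ?thesis
    unfolding iff using 1 2 3
    by (intro pred_intros_logic pred_intros_finite) auto
qed


section \<open>Gaussian samples\<close>

lemma prob_space_std_gaussian: "prob_space (std_gaussian I)"
  unfolding std_gaussian_def by (intro prob_space_PiM prob_space_normal_density) simp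

lemma measurable_std_gaussian_component:
  assumes "i \<in> I"
  shows "(\<lambda>g. g i) \<in> borel_measurable (std_gaussian I)"
proof -
  have "(\<lambda>g. g i) \<in> std_gaussian I \<rightarrow>\<^sub>M density lborel std_normal_density"
    unfolding std_gaussian_def using assms by (rule measurable_component_singleton)
  then show ?thesis by (simp cong: measurable_cong_sets)
qed

lemma measurable_vec_block: "measurable_vec (std_gaussian UNIV) n (block n i)"
  by (simp add: measurable_vec_def block_def measurable_std_gaussian_component)

lemma measurable_vec_std_gaussian: "measurable_vec (std_gaussian {..<n}) n (Matrix.vec n)"
  by (simp add: measurable_vec_def measurable_std_gaussian_component)

text \<open>Restricting the tape to the positions of block \<open>i\<close> is an injective
  reindexing of a product of equal measures, so every block has the law of one Gaussian
  vector.\<close>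

lemma measure_block_eq_gauss_prob:
  assumes Q: "Measurable.pred (std_gaussian {..<n}) (\<lambda>g. Q (Matrix.vec n g))"
  shows "measure (std_gaussian UNIV) {\<omega> \<in> space (std_gaussian UNIV). Q (block n i \<omega>)} = gauss_prob n Q"
proof -
  let ?N = "density lborel std_normal_density" and ?f = "\<lambda>j. j + i * n"
  let ?t = "\<lambda>\<omega>. \<lambda>j\<in>{..<n}. \<omega> (?f j)" and ?A = "{g \<in> space (std_gaussian {..<n}). Q (Matrix.vec n g)}"
  have d: "distr (std_gaussian UNIV) (std_gaussian {..<n}) ?t = std_gaussian {..<n}"
    unfolding std_gaussian_def
    using distr_PiM_reindex[of UNIV "\<lambda>_. ?N" ?f "{..<n}"] prob_space_normal_density
    by (simp add: inj_on_def)
  have t: "?t \<in> std_gaussian UNIV \<rightarrow>\<^sub>M std_gaussian {..<n}"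
    unfolding std_gaussian_def by (intro measurable_restrict measurable_component_singleton) simp
  have A: "?A \<in> sets (std_gaussian {..<n})" using Q by (simp add: pred_def)
  have v: "Matrix.vec n (?t \<omega>) = block n i \<omega>" for \<omega>
    by (intro eq_vecI) (simp_all add: block_def)
  have "gauss_prob n Q = measure (distr (std_gaussian UNIV) (std_gaussian {..<n}) ?t) ?A"
    unfolding d gauss_prob_def ..
  also have "\<dots> = measure (std_gaussian UNIV) (?t -` ?A \<inter> space (std_gaussian UNIV))"
    by (rule measure_distr[OF t A])
  also have "?t -` ?A \<inter> space (std_gaussian UNIV) = {\<omega> \<in> space (std_gaussian UNIV). Q (block n i \<omega>)}"
    using measurable_space[OF t] by (auto simp: v)
  finally show ?thesis ..
qed

text \<open>\<open>comb_seq n\<close> puts the first \<open>n\<close> entries of one tape in front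
  of another tape, so the first round depends on the first tape alone and all later rounds on the
  second.\<close>

lemma block_comb_seq:
  "block n 0 (comb_seq n \<omega> \<omega>') = block n 0 \<omega>"
  "block n (Suc i) (comb_seq n \<omega> \<omega>') = block n i \<omega>'"
  by (auto simp: block_def comb_seq_def intro!: eq_vecI)

text \<open>Conditioning on the first round: gluing two independent tapes yields a tape of the same
  law, so Fubini integrates the later rounds with the first one fixed.\<close>

lemma emeasure_std_gaussian_split:
  assumes \<Phi>: "Measurable.pred (std_gaussian UNIV) \<Phi>"
  shows "emeasure (std_gaussian UNIV) {\<omega> \<in> space (std_gaussian UNIV). \<Phi> \<omega>} =
    (\<integral>\<^sup>+\<omega>. emeasure (std_gaussian UNIV) {\<omega>' \<in> space (std_gaussian UNIV). \<Phi> (comb_seq n \<omega> \<omega>')}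
      \<partial>std_gaussian UNIV)"
proof -
  let ?N = "density lborel std_normal_density"
  interpret N: prob_space ?N by (rule prob_space_normal_density) simp
  interpret sequence_space ?N by standard
  have S: "std_gaussian UNIV = S" by (simp add: std_gaussian_def)
  interpret P: prob_space S unfolding S[symmetric] by (rule prob_space_std_gaussian)
  let ?E = "{\<omega> \<in> space S. \<Phi> \<omega>}" and ?c = "\<lambda>(\<omega>, \<omega>'). comb_seq n \<omega> \<omega>'"
  have E: "?E \<in> sets S" using \<Phi> unfolding S by (simp add: pred_def)
  have X: "?c -` ?E \<inter> space (S \<Otimes>\<^sub>M S) \<in> sets (S \<Otimes>\<^sub>M S)"
    by (rule measurable_sets[OF measurable_comb_seq E])
  have "emeasure S ?E = emeasure (distr (S \<Otimes>\<^sub>M S) S ?c) ?E" by (simp only: PiM_comb_seq)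
  also have "\<dots> = emeasure (S \<Otimes>\<^sub>M S) (?c -` ?E \<inter> space (S \<Otimes>\<^sub>M S))"
    by (rule emeasure_distr[OF measurable_comb_seq E])
  also have "\<dots> = (\<integral>\<^sup>+\<omega>. emeasure S (Pair \<omega> -` (?c -` ?E \<inter> space (S \<Otimes>\<^sub>M S))) \<partial>S)"
    by (rule P.emeasure_pair_measure_alt[OF X])
  also have "\<dots> = (\<integral>\<^sup>+\<omega>. emeasure S {\<omega>' \<in> space S. \<Phi> (comb_seq n \<omega> \<omega>')} \<partial>S)"
  proof (rule nn_integral_cong)
    fix \<omega> assume w: "\<omega> \<in> space S"
    have "comb_seq n \<omega> \<omega>' \<in> space S" if "\<omega>' \<in> space S" for \<omega>'
      using measurable_space[OF measurable_comb_seq, of "(\<omega>, \<omega>')" ?N n] w that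
      by (simp add: space_pair_measure)
    then have "Pair \<omega> -` (?c -` ?E \<inter> space (S \<Otimes>\<^sub>M S)) = {\<omega>' \<in> space S. \<Phi> (comb_seq n \<omega> \<omega>')}"
      using w by (auto simp: space_pair_measure)
    then show "emeasure S (Pair \<omega> -` (?c -` ?E \<inter> space (S \<Otimes>\<^sub>M S))) =
        emeasure S {\<omega>' \<in> space S. \<Phi> (comb_seq n \<omega> \<omega>')}" by simp
  qed
  finally show ?thesis unfolding S .
qed

section \<open>The local gradient as a random vector with finitely many values\<close>

lemma simple_function_pos:
  assumes y: "measurable_vec N m y"
  shows "simple_function N (\<lambda>\<omega>. pos (y \<omega>))"
  unfolding simple_function_def
proof (intro conjI ballI)
  have "(\<lambda>\<omega>. pos (y \<omega>)) ` space N \<subseteq> Pow {..<m}"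
    using measurable_vecD(2)[OF y] by (auto simp: pos_def)
  then show "finite ((\<lambda>\<omega>. pos (y \<omega>)) ` space N)" by (rule finite_subset) simp
  fix T assume "T \<in> (\<lambda>\<omega>. pos (y \<omega>)) ` space N"
  then have T: "T \<subseteq> {..<m}" using measurable_vecD(2)[OF y] by (auto simp: pos_def)
  have "Measurable.pred N (\<lambda>\<omega>. 0 < y \<omega> $ i \<longleftrightarrow> i \<in> T)" if "i < m" for i
    using measurable_vecD(3)[OF y that] by measurable
  then have "Measurable.pred N (\<lambda>\<omega>. \<forall>i\<in>{..<m}. 0 < y \<omega> $ i \<longleftrightarrow> i \<in> T)"
    by (intro pred_intros_finite(3)) simp_all
  then have "{\<omega> \<in> space N. \<forall>i\<in>{..<m}. 0 < y \<omega> $ i \<longleftrightarrow> i \<in> T} \<in> sets N" by (simp add: pred_def)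
  also have "{\<omega> \<in> space N. \<forall>i\<in>{..<m}. 0 < y \<omega> $ i \<longleftrightarrow> i \<in> T} = (\<lambda>\<omega>. pos (y \<omega>)) -` {T} \<inter> space N"
    using T measurable_vecD(2)[OF y] by (auto simp: pos_def)
  finally show "(\<lambda>\<omega>. pos (y \<omega>)) -` {T} \<inter> space N \<in> sets N" .
qed

lemma simple_function_patterns:
  assumes "layers ks k Ws" "A \<in> carrier_mat k n" "measurable_vec N n x"
  shows "simple_function N (\<lambda>\<omega>. patterns Ws A (x \<omega>))"
  using assms
proof (induction ks k Ws rule: layers.induct)
  case (2 a ks k W Ws)
  then have "measurable_vec N a (\<lambda>\<omega>. W *\<^sub>v hidden Ws A (x \<omega>))"
    by (intro measurable_vec_mult[of W a "hd (ks @ [k])"] measurable_vec_hidden) simp_all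
  then have "simple_function N (\<lambda>\<omega>. pos (W *\<^sub>v hidden Ws A (x \<omega>)))"
    by (rule simple_function_pos)
  then show ?case
    using simple_function_compose2[of N _ "\<lambda>\<omega>. patterns Ws A (x \<omega>)" "(#)"] 2 by simp
qed simp_all

lemma simple_function_local_gradient:
  assumes "network_shape n k ks w Ws A" "measurable_vec N n x"
  shows "simple_function N (\<lambda>\<omega>. local_gradient w Ws A (x \<omega>))"
proof -
  have *: "A \<in> carrier_mat k n" "layers ks k Ws" using assms(1) by (auto simp: network_shape_iff)
  show ?thesis
    unfolding local_gradient_def linear_part_def
    by (rule simple_function_compose2[OF simple_function_patterns[OF *(2,1) assms(2)]
          simple_function_pos[OF measurable_vec_mult[OF *(1) assms(2)]],
          of "\<lambda>Ss S. (mask_prod Ws Ss (mask_rows S A))\<^sup>T *\<^sub>v w"])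
qed

text \<open>\<open>Q\<close> can be arbitrary because \<open>f\<close> has finitely many values with
  measurable fibres. For local gradients this settles span membership and independence at
  once.\<close>

lemma pred_simple_function:
  assumes "simple_function N f"
  shows "Measurable.pred N (\<lambda>\<omega>. Q (f \<omega>))"
proof -
  have "f \<in> N \<rightarrow>\<^sub>M count_space UNIV" using assms by (rule measurable_simple_function)
  then show ?thesis by (rule measurable_compose) simp
qed

lemma simple_function_map:
  assumes "\<And>i. i \<in> set is \<Longrightarrow> simple_function N (f i)"
  shows "simple_function N (\<lambda>\<omega>. map (\<lambda>i. f i \<omega>) is)"
  using assms
proof (induction "is")
  case (Cons i "is")
  then show ?case using simple_function_compose2[of N "f i" "\<lambda>\<omega>. map (\<lambda>i. f i \<omega>) is" "(#)"] by simp
qed simp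

text \<open>The density is at most \<open>1 / sqrt (2 * pi) \<le> 1\<close>, so the mass is at most
  the length.\<close>

lemma emeasure_std_normal_interval:
  assumes "0 \<le> \<epsilon>"
  shows "emeasure (density lborel std_normal_density) {a - \<epsilon>..a + \<epsilon>} \<le> ennreal (2 * \<epsilon>)"
proof -
  let ?I = "{a - \<epsilon>..a + \<epsilon>}"
  have le: "std_normal_density y \<le> 1" for y
  proof -
    have "1 \<le> sqrt (2 * pi)" using pi_gt3 by (intro real_le_rsqrt) simp
    then have "1 / sqrt (2 * pi) * exp (- y\<^sup>2 / 2) \<le> 1 * 1"
      by (intro mult_mono) auto
    then show ?thesis by (simp add: std_normal_density_def)
  qed
  have "emeasure (density lborel std_normal_density) ?I =
      (\<integral>\<^sup>+y. ennreal (std_normal_density y) * indicator ?I y \<partial>lborel)"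
    by (rule emeasure_density) auto
  also have "\<dots> \<le> (\<integral>\<^sup>+y. 1 * indicator ?I y \<partial>lborel)"
    using le by (intro nn_integral_mono mult_right_mono) (simp_all add: ennreal_le_1)
  also have "\<dots> = ennreal (2 * \<epsilon>)" using assms by simp
  finally show ?thesis .
qed

text \<open>With the other coordinates fixed, the coordinate of largest weight in \<open>l\<close>
  must lie in an interval of half-length \<epsilon>: its weight cancels, so the bound does not
  depend on \<open>l\<close>.\<close>

lemma gauss_prob_near_hyperplane:
  assumes l: "l \<in> carrier_vec n" "l \<noteq> 0\<^sub>v n" and \<epsilon>: "0 < \<epsilon>"
  shows "gauss_prob n (\<lambda>x. \<exists>j<n. \<bar>l \<bullet> x\<bar> \<le> \<epsilon> * \<bar>l $ j\<bar>) \<le> 2 * \<epsilon>"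
proof -
  let ?N = "density lborel std_normal_density"
  interpret N: prob_space ?N by (rule prob_space_normal_density) simp
  interpret product_sigma_finite "\<lambda>_::nat. ?N" by standard
  interpret G: prob_space "std_gaussian {..<n}" by (rule prob_space_std_gaussian)
  obtain i where i: "i < n" "l $ i \<noteq> 0" using l by (metis carrier_vecD eq_vecI index_zero_vec)
  \<comment> \<open>For a maximal coordinate, the event with this single \<open>j\<close> contains
    those of all other coordinates.\<close>
  obtain j where j: "j < n" "\<And>i. i < n \<Longrightarrow> \<bar>l $ i\<bar> \<le> \<bar>l $ j\<bar>"
  proof -
    let ?M = "(\<lambda>i. \<bar>l $ i\<bar>) ` {..<n}"
    have "?M \<noteq> {}" using i by auto
    then have "Max ?M \<in> ?M" by (intro Max_in) simp_all
    then obtain j where "j < n" "\<bar>l $ j\<bar> = Max ?M" by auto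
    moreover have "\<bar>l $ i\<bar> \<le> Max ?M" if "i < n" for i using that by (intro Max_ge) simp_all
    ultimately show thesis using that by metis
  qed
  have lj: "l $ j \<noteq> 0" using j(2)[OF i(1)] i(2) by auto
  let ?B = "{g \<in> space (std_gaussian {..<n}). \<bar>l \<bullet> Matrix.vec n g\<bar> \<le> \<epsilon> * \<bar>l $ j\<bar>}"
  let ?I = "{..<n} - {j}"
  have ins: "insert j ?I = {..<n}" using j by auto
  have dot: "l \<bullet> Matrix.vec n (x(j := y)) = (\<Sum>i\<in>?I. l $ i * x i) + l $ j * y" for x y
  proof -
    have "l \<bullet> Matrix.vec n (x(j := y)) = (\<Sum>i<n. l $ i * (x(j := y)) i)"
      by (simp add: scalar_prod_def lessThan_atLeast0)
    also have "\<dots> = l $ j * y + (\<Sum>i\<in>?I. l $ i * (x(j := y)) i)"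
      using j by (subst sum.remove[of _ j]) auto
    also have "(\<Sum>i\<in>?I. l $ i * (x(j := y)) i) = (\<Sum>i\<in>?I. l $ i * x i)"
      by (intro sum.cong) auto
    finally show ?thesis by (simp only: add.commute)
  qed
  have meas: "(\<lambda>g. l \<bullet> Matrix.vec n g) \<in> borel_measurable (std_gaussian {..<n})"
    by (rule measurable_scalar_prod[OF measurable_vec_const[OF l(1)] measurable_vec_std_gaussian])
  have B: "?B \<in> sets (std_gaussian {..<n})" using meas by measurable
  have "emeasure (std_gaussian {..<n}) ?B = (\<integral>\<^sup>+g. indicator ?B g \<partial>Pi\<^sub>M (insert j ?I) (\<lambda>_. ?N))"
    unfolding ins std_gaussian_def[symmetric] using B by simp
  also have "\<dots> = (\<integral>\<^sup>+x. (\<integral>\<^sup>+y. indicator ?B (x(j := y)) \<partial>?N) \<partial>Pi\<^sub>M ?I (\<lambda>_. ?N))"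
  proof (rule product_nn_integral_insert)
    show "indicator ?B \<in> borel_measurable (Pi\<^sub>M (insert j ?I) (\<lambda>_. ?N))"
      unfolding ins std_gaussian_def[symmetric] using B by (rule borel_measurable_indicator)
  qed simp_all
  also have "\<dots> \<le> (\<integral>\<^sup>+x. ennreal (2 * \<epsilon>) \<partial>Pi\<^sub>M ?I (\<lambda>_. ?N))"
  proof (rule nn_integral_mono)
    fix x :: "nat \<Rightarrow> real"
    \<comment> \<open>The value of coordinate \<open>j\<close> at which the scalar product vanishes,
      the others being fixed.\<close>
    define a where "a = - (\<Sum>i\<in>?I. l $ i * x i) / l $ j"
    have "indicator ?B (x(j := y)) \<le> (indicator {a - \<epsilon>..a + \<epsilon>} y :: ennreal)" for y
    proof -
      have "y \<in> {a - \<epsilon>..a + \<epsilon>}" if "\<bar>l \<bullet> Matrix.vec n (x(j := y))\<bar> \<le> \<epsilon> * \<bar>l $ j\<bar>"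
      proof -
        have "(\<Sum>i\<in>?I. l $ i * x i) + l $ j * y = (y - a) * l $ j"
          using lj by (simp add: a_def field_simps)
        then have "\<bar>y - a\<bar> * \<bar>l $ j\<bar> \<le> \<epsilon> * \<bar>l $ j\<bar>"
          using that unfolding dot by (simp add: abs_mult)
        then have "\<bar>y - a\<bar> \<le> \<epsilon>" using lj by simp
        then show ?thesis by auto
      qed
      then show ?thesis by (auto simp: indicator_def)
    qed
    then have "(\<integral>\<^sup>+y. indicator ?B (x(j := y)) \<partial>?N) \<le> (\<integral>\<^sup>+y. indicator {a - \<epsilon>..a + \<epsilon>} y \<partial>?N)"
      by (intro nn_integral_mono)
    also have "\<dots> = emeasure ?N {a - \<epsilon>..a + \<epsilon>}" by simp
    also have "\<dots> \<le> ennreal (2 * \<epsilon>)" using \<epsilon> by (intro emeasure_std_normal_interval) simp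
    finally show "(\<integral>\<^sup>+y. indicator ?B (x(j := y)) \<partial>?N) \<le> ennreal (2 * \<epsilon>)" .
  qed
  also have "\<dots> = ennreal (2 * \<epsilon>)"
    using prob_space.emeasure_space_1[OF prob_space_std_gaussian[of ?I]] by (simp add: std_gaussian_def)
  finally have "measure (std_gaussian {..<n}) ?B \<le> 2 * \<epsilon>"
    using \<epsilon> by (simp add: G.emeasure_eq_measure)
  moreover have "gauss_prob n (\<lambda>x. \<exists>j<n. \<bar>l \<bullet> x\<bar> \<le> \<epsilon> * \<bar>l $ j\<bar>) \<le> measure (std_gaussian {..<n}) ?B"
    unfolding gauss_prob_def
  proof (rule G.finite_measure_mono[OF _ B], safe)
    fix g i assume "i < n" "\<bar>l \<bullet> Matrix.vec n g\<bar> \<le> \<epsilon> * \<bar>l $ i\<bar>"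
    then show "\<bar>l \<bullet> Matrix.vec n g\<bar> \<le> \<epsilon> * \<bar>l $ j\<bar>"
      using j(2)[of i] \<epsilon> mult_left_mono[of "\<bar>l $ i\<bar>" "\<bar>l $ j\<bar>" \<epsilon>] by linarith
  qed
  ultimately show ?thesis by linarith
qed

lemma measurable_near_hyperplane:
  assumes "l \<in> carrier_vec n" "measurable_vec N n x"
  shows "Measurable.pred N (\<lambda>\<omega>. \<exists>j<n. \<bar>l \<bullet> x \<omega>\<bar> \<le> \<epsilon> * \<bar>l $ j\<bar>)"
proof -
  have "(\<lambda>\<omega>. l \<bullet> x \<omega>) \<in> borel_measurable N"
    by (rule measurable_scalar_prod[OF measurable_vec_const[OF assms(1)] assms(2)])
  then show ?thesis by measurable
qed

text \<open>A union bound over the rounds and the non-zero normals; since each hyperplane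
  contributes at most \<open>2 * \<epsilon>\<close>, only the number of normals enters.\<close>

lemma prob_not_clear_le:
  assumes L: "finite L" "L \<subseteq> carrier_vec n" "card L \<le> c" and \<epsilon>: "0 < \<epsilon>"
  shows "{\<omega> \<in> space (std_gaussian UNIV). \<exists>i<r. \<not> clear_of n \<epsilon> L (block n i \<omega>)} \<in> sets (std_gaussian UNIV)"
    "measure (std_gaussian UNIV)
       {\<omega> \<in> space (std_gaussian UNIV). \<exists>i<r. \<not> clear_of n \<epsilon> L (block n i \<omega>)} \<le> real r * real c * (2 * \<epsilon>)"
proof -
  let ?P = "std_gaussian UNIV" and ?L = "L - {0\<^sub>v n}"
  let ?E = "\<lambda>(i, l). {\<omega> \<in> space ?P. \<exists>j<n. \<bar>l \<bullet> block n i \<omega>\<bar> \<le> \<epsilon> * \<bar>l $ j\<bar>}"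
  have eq: "{\<omega> \<in> space ?P. \<exists>i<r. \<not> clear_of n \<epsilon> L (block n i \<omega>)} = (\<Union>p\<in>{..<r} \<times> ?L. ?E p)"
    by (auto simp: clear_of_def not_less)
  have E: "?E p \<in> sets ?P" if p: "p \<in> {..<r} \<times> ?L" for p
  proof -
    obtain i l where il: "p = (i, l)" "l \<in> carrier_vec n" using p L(2) by blast
    show ?thesis
      using measurable_near_hyperplane[OF il(2) measurable_vec_block]
      unfolding il(1) pred_def prod.case .
  qed
  show "{\<omega> \<in> space ?P. \<exists>i<r. \<not> clear_of n \<epsilon> L (block n i \<omega>)} \<in> sets ?P"
    unfolding eq using L(1) E by (intro sets.finite_UN) auto
  have "measure ?P (\<Union>p\<in>{..<r} \<times> ?L. ?E p) \<le> (\<Sum>p\<in>{..<r} \<times> ?L. measure ?P (?E p))"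
    using L(1) E by (intro measure_UNION_le) auto
  also have "\<dots> \<le> (\<Sum>p\<in>{..<r} \<times> ?L. 2 * \<epsilon>)"
  proof (rule sum_mono)
    fix p assume p: "p \<in> {..<r} \<times> ?L"
    obtain i l where il: "p = (i, l)" "l \<in> carrier_vec n" "l \<noteq> 0\<^sub>v n" using p L(2) by blast
    show "measure ?P (?E p) \<le> 2 * \<epsilon>"
      using gauss_prob_near_hyperplane[OF il(2,3) \<epsilon>]
        measure_block_eq_gauss_prob[OF measurable_near_hyperplane[OF il(2) measurable_vec_std_gaussian], where i=i and \<epsilon>1=\<epsilon>]
      unfolding il(1) by simp
  qed
  also have "\<dots> = real (r * card ?L) * (2 * \<epsilon>)" by (simp add: card_cartesian_product)
  also have "\<dots> \<le> real (r * c) * (2 * \<epsilon>)"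
    using card_mono[OF L(1), of ?L] L(3) \<epsilon> by (intro mult_right_mono of_nat_mono mult_left_mono) auto
  finally show "measure ?P {\<omega> \<in> space ?P. \<exists>i<r. \<not> clear_of n \<epsilon> L (block n i \<omega>)} \<le> real r * real c * (2 * \<epsilon>)"
    unfolding eq by simp
qed


section \<open>The growth of the span\<close>

text \<open>The potential \<open>2\<^bsup>d - 1\<^esup>\<close>, where \<open>d\<close> is the number of missing dimensions, shrinks in every
  round by the factor \<open>1 - p / 2\<close> in expectation.  It is \<open>0\<close> rather than \<open>1 / 2\<close> for \<open>d = 0\<close>, so the
  bound has no superfluous factor when \<open>k = 1\<close>.\<close>

lemma prob_few_independent_le:
  fixes \<zeta> :: "real Matrix.vec \<Rightarrow> real Matrix.vec"
  assumes carrier: "\<And>x. \<zeta> x \<in> carrier_vec n"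
    and simple: "\<And>i. simple_function (std_gaussian UNIV) (\<lambda>\<omega>. \<zeta> (block n i \<omega>))"
    and chance: "\<And>U. finite U \<Longrightarrow> U \<subseteq> carrier_vec n \<Longrightarrow> card U < m \<Longrightarrow>
      measure (std_gaussian UNIV) {\<omega> \<in> space (std_gaussian UNIV). \<zeta> (block n 0 \<omega>) \<in> vspan n U} \<le> 1 - p"
    and p: "0 \<le> p" "p \<le> 1"
    and U: "finite U" "U \<subseteq> carrier_vec n" "vindep n U" "card U + d = m" "0 < d"
  shows "emeasure (std_gaussian UNIV) {\<omega> \<in> space (std_gaussian UNIV).
      \<not> (\<exists>T\<subseteq>U \<union> (\<lambda>i. \<zeta> (block n i \<omega>)) ` {..<r}. vindep n T \<and> card T = m)}
    \<le> ennreal (2 ^ (d - 1) * (1 - p / 2) ^ r)"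
  using U
proof (induction r arbitrary: U d)
  case 0
  interpret P: prob_space "std_gaussian UNIV" by (rule prob_space_std_gaussian)
  have "(1::real) \<le> 2 ^ (d - 1)" by simp
  then show ?case
    by (intro order.trans[OF P.measure_le_1]) (simp add: P.emeasure_eq_measure)
next
  case (Suc r)
  let ?P = "std_gaussian UNIV"
  interpret P: prob_space ?P by (rule prob_space_std_gaussian)
  define fail where "fail U Z \<longleftrightarrow> \<not> (\<exists>T\<subseteq>U \<union> Z. vindep n T \<and> card T = m)" for U Z
  let ?Z = "\<lambda>r \<omega>. (\<lambda>i. \<zeta> (block n i \<omega>)) ` {..<r}"
  define q where "q = 1 - p / 2"
  have q: "0 \<le> q" using p by (simp add: q_def)
  \<comment> \<open>Bounds for the failure of the remaining \<open>r\<close> rounds: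
    \<open>a\<close> if the first vector stays in the span of \<open>U\<close>, \<open>b\<close> if
    it leaves it and one dimension fewer is missing.\<close>
  define a where "a = 2 ^ (d - 1) * q ^ r"
  define b where "b = (if d = 1 then 0 else 2 ^ (d - 2) * q ^ r)"
  have ab: "0 \<le> b" "b \<le> a / 2"
  proof -
    show "0 \<le> b" using q by (simp add: b_def)
    show "b \<le> a / 2"
    proof (cases "d = 1")
      case False
      then have "d - 1 = Suc (d - 2)" using \<open>0 < d\<close> by simp
      then show ?thesis using False by (simp add: a_def b_def)
    qed (use q in \<open>simp add: a_def b_def\<close>)
  qed
  have pred: "Measurable.pred ?P (\<lambda>\<omega>. fail U (?Z r \<omega>))" for U r
  proof -
    have "simple_function ?P (\<lambda>\<omega>. map (\<lambda>i. \<zeta> (block n i \<omega>)) [0..<r])"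
      by (rule simple_function_map[OF simple])
    then have "Measurable.pred ?P (\<lambda>\<omega>. fail U (set (map (\<lambda>i. \<zeta> (block n i \<omega>)) [0..<r])))"
      by (rule pred_simple_function)
    then show ?thesis by (simp add: lessThan_atLeast0)
  qed
  have sets: "{\<omega> \<in> space ?P. fail U (?Z r \<omega>)} \<in> sets ?P" for U r
    using pred by (simp only: pred_def)
  let ?A = "{\<omega> \<in> space ?P. \<zeta> (block n 0 \<omega>) \<in> vspan n U}"
  have A: "?A \<in> sets ?P"
    using pred_simple_function[OF simple, of "\<lambda>z. z \<in> vspan n U" 0] by (simp only: pred_def)
  have Z: "?Z (Suc r) (comb_seq n \<omega> \<omega>') = insert (\<zeta> (block n 0 \<omega>)) (?Z r \<omega>')" for \<omega> \<omega>'
    by (simp add: lessThan_Suc_eq_insert_0 image_image block_comb_seq)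
  have IH: "emeasure ?P {\<omega> \<in> space ?P. fail U' (?Z r \<omega>)} \<le> ennreal (2 ^ (d' - 1) * q ^ r)"
    if "finite U'" "U' \<subseteq> carrier_vec n" "vindep n U'" "card U' + d' = m" "0 < d'" for U' d'
    using Suc.IH[OF that] unfolding fail_def q_def .
  have step: "emeasure ?P {\<omega>' \<in> space ?P. fail U (?Z (Suc r) (comb_seq n \<omega> \<omega>'))} \<le>
      ennreal b + ennreal (a - b) * indicator ?A \<omega>" if w: "\<omega> \<in> space ?P" for \<omega>
  proof (cases "\<zeta> (block n 0 \<omega>) \<in> vspan n U")
    case True
    have "{\<omega>' \<in> space ?P. fail U (?Z (Suc r) (comb_seq n \<omega> \<omega>'))} \<subseteq>
        {\<omega>' \<in> space ?P. fail U (?Z r \<omega>')}"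
      unfolding Z fail_def by blast
    then have "emeasure ?P {\<omega>' \<in> space ?P. fail U (?Z (Suc r) (comb_seq n \<omega> \<omega>'))} \<le>
        emeasure ?P {\<omega>' \<in> space ?P. fail U (?Z r \<omega>')}"
      by (rule emeasure_mono[OF _ sets])
    also have "\<dots> \<le> ennreal a" unfolding a_def using Suc.prems by (rule IH)
    also have "\<dots> = ennreal b + ennreal (a - b) * indicator ?A \<omega>"
      using True w ab by (simp flip: ennreal_plus)
    finally show ?thesis .
  next
    case False
    define U' where "U' = insert (\<zeta> (block n 0 \<omega>)) U"
    have U': "finite U'" "U' \<subseteq> carrier_vec n" "vindep n U'"
      using Suc.prems carrier vindep_insert[OF Suc.prems(2,3) carrier False] by (auto simp: U'_def)
    have "\<zeta> (block n 0 \<omega>) \<notin> U"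
    proof
      interpret vec_space "TYPE(real)" n .
      assume "\<zeta> (block n 0 \<omega>) \<in> U"
      then show False using False in_own_span[OF Suc.prems(2)] by blast
    qed
    then have card: "card U' = Suc (card U)" using Suc.prems(1) by (simp add: U'_def)
    have eq: "fail U (?Z (Suc r) (comb_seq n \<omega> \<omega>')) \<longleftrightarrow> fail U' (?Z r \<omega>')" for \<omega>'
      unfolding Z fail_def U'_def by simp
    have "emeasure ?P {\<omega>' \<in> space ?P. fail U' (?Z r \<omega>')} \<le> ennreal b"
    proof (cases "d = 1")
      case True
      \<comment> \<open>The target is already reached, so failure is impossible; this is why
        \<open>b\<close> is 0 for \<open>d = 1\<close>.\<close>
      then have "card U' = m" using card Suc.prems(4) by simp
      then have "\<not> fail U' Z" for Z unfolding fail_def using U'(3) by blast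
      then show ?thesis by simp
    next
      case False
      then have "emeasure ?P {\<omega>' \<in> space ?P. fail U' (?Z r \<omega>')} \<le> ennreal (2 ^ (d - 1 - 1) * q ^ r)"
        using Suc.prems card by (intro IH U') auto
      then show ?thesis using False by (simp add: b_def numeral_2_eq_2)
    qed
    then show ?thesis unfolding eq using False by simp
  qed
  define s where "s = measure ?P ?A"
  have s: "s \<le> 1 - p" unfolding s_def using Suc.prems by (intro chance) auto
  have s0: "0 \<le> s" by (simp add: s_def)
  have "emeasure ?P {\<omega> \<in> space ?P. fail U (?Z (Suc r) \<omega>)} =
      (\<integral>\<^sup>+\<omega>. emeasure ?P {\<omega>' \<in> space ?P. fail U (?Z (Suc r) (comb_seq n \<omega> \<omega>'))} \<partial>?P)"
    by (rule emeasure_std_gaussian_split[OF pred])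
  also have "\<dots> \<le> (\<integral>\<^sup>+\<omega>. ennreal b + ennreal (a - b) * indicator ?A \<omega> \<partial>?P)"
    by (rule nn_integral_mono[OF step])
  also have "\<dots> = ennreal b + ennreal (a - b) * emeasure ?P ?A"
    using A by (simp add: nn_integral_add nn_integral_cmult_indicator P.emeasure_space_1)
  also have "\<dots> = ennreal (b + (a - b) * s)"
    using ab s0 by (simp add: P.emeasure_eq_measure s_def ennreal_plus ennreal_mult)
  also have "\<dots> \<le> ennreal (a * q)"
  proof (rule ennreal_leI)
    \<comment> \<open>With \<open>b \<le> a / 2\<close> and \<open>s \<le> 1 - p\<close>, the
      average \<open>b * (1 - s) + a * s\<close> is at most
      \<open>a * (1 + s) / 2 \<le> a * (1 - p / 2)\<close>.\<close>
    have "b * (1 - s) \<le> a / 2 * (1 - s)" using ab s p by (intro mult_right_mono) auto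
    moreover have "a / 2 * (1 + s) \<le> a / 2 * (2 - p)" using ab s by (intro mult_left_mono) auto
    ultimately show "b + (a - b) * s \<le> a * q" by (simp add: q_def field_simps)
  qed
  also have "a * q = 2 ^ (d - 1) * (1 - p / 2) ^ Suc r" by (simp add: a_def q_def)
  finally show ?case unfolding fail_def .
qed

text \<open>The pattern of \<open>relu (A *\<^sub>v x)\<close> is the indicator vector of
  \<open>pos (A *\<^sub>v x)\<close>, and the events for different sets are disjoint, so Assumption
  1 can be summed over \<open>F\<close>.\<close>

lemma gauss_prob_pos_mem_ge:
  assumes A: "A \<in> carrier_mat k n" and a1: "assumption1 n k \<gamma> A" and F: "F \<subseteq> Pow {..<k}"
  shows "real (card F) * (\<gamma> / 2 ^ k) \<le> gauss_prob n (\<lambda>x. pos (A *\<^sub>v x) \<in> F)"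
proof -
  let ?G = "std_gaussian {..<n}" and ?E = "\<lambda>T. {g \<in> space (std_gaussian {..<n}). pos (A *\<^sub>v Matrix.vec n g) = T}"
  interpret G: prob_space ?G by (rule prob_space_std_gaussian)
  have E: "?E T \<in> sets ?G" for T
    using pred_simple_function[OF simple_function_pos[OF measurable_vec_mult[OF A measurable_vec_std_gaussian]],
        of "\<lambda>S. S = T"] by (simp only: pred_def)
  have fin: "finite F" using F by (rule finite_subset) simp
  have ge: "\<gamma> / 2 ^ k \<le> measure ?G (?E T)" if "T \<in> F" for T
  proof -
    define S :: "nat Matrix.vec" where "S = Matrix.vec k (\<lambda>i. if i \<in> T then 1 else 0)"
    have T: "T \<subseteq> {..<k}" using that F by auto
    have "sign_pattern (relu (A *\<^sub>v x)) = S \<longleftrightarrow> pos (A *\<^sub>v x) = T" for x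
    proof
      assume eq: "sign_pattern (relu (A *\<^sub>v x)) = S"
      have "i \<in> pos (A *\<^sub>v x) \<longleftrightarrow> i \<in> T" if "i < k" for i
      proof -
        have "sign_pattern (relu (A *\<^sub>v x)) $ i = S $ i" using eq by simp
        then show ?thesis using that A unfolding sign_pattern_relu S_def by (simp split: if_splits)
      qed
      moreover have "pos (A *\<^sub>v x) \<subseteq> {..<k}" using A by (auto simp: pos_def)
      ultimately show "pos (A *\<^sub>v x) = T" using T by blast
    next
      assume "pos (A *\<^sub>v x) = T"
      then show "sign_pattern (relu (A *\<^sub>v x)) = S" using A by (simp add: sign_pattern_relu S_def)
    qed
    then have "gauss_prob n (\<lambda>g. sign_pattern (relu (A *\<^sub>v g)) = S) = measure ?G (?E T)"
      by (simp add: gauss_prob_def)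
    moreover have "S \<in> carrier_vec k" "\<forall>i<k. S $ i \<in> {0, 1}" by (simp_all add: S_def)
    ultimately show ?thesis using a1 unfolding assumption1_def by metis
  qed
  have "real (card F) * (\<gamma> / 2 ^ k) \<le> (\<Sum>T\<in>F. measure ?G (?E T))"
    using sum_mono[OF ge, of F "\<lambda>T. T"] by simp
  also have "\<dots> = measure ?G (\<Union>T\<in>F. ?E T)"
    using fin E by (intro G.finite_measure_finite_Union[symmetric]) (auto simp: disjoint_family_on_def)
  also have "(\<Union>T\<in>F. ?E T) = {g \<in> space ?G. pos (A *\<^sub>v Matrix.vec n g) \<in> F}" by auto
  finally show ?thesis by (simp add: gauss_prob_def)
qed

text \<open>All \<open>2 ^ k\<close> patterns together have probability at most 1.\<close>

lemma gamma_le_1: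
  assumes "A \<in> carrier_mat k n" "assumption1 n k \<gamma> A"
  shows "\<gamma> \<le> 1"
proof -
  have "\<gamma> = real (card (Pow {..<k})) * (\<gamma> / 2 ^ k)" by (simp add: card_Pow)
  also have "\<dots> \<le> gauss_prob n (\<lambda>x. pos (A *\<^sub>v x) \<in> Pow {..<k})"
    by (rule gauss_prob_pos_mem_ge[OF assms]) simp
  also have "\<dots> \<le> 1"
    unfolding gauss_prob_def by (rule prob_space.prob_le_1[OF prob_space_std_gaussian])
  finally show ?thesis .
qed

lemma gauss_prob_gradient_in_span_le:
  assumes shape: "network_shape n k ks w Ws A" and rank: "vec_space.rank k A = k"
    and a1: "assumption1 n k \<gamma> A" and a2: "assumption2 n k ks \<gamma> w Ws A" and \<gamma>: "0 < \<gamma>" and k: "0 < k"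
    and U: "finite U" "U \<subseteq> carrier_vec n" "2 * card U < k"
  shows "gauss_prob n (\<lambda>x. local_gradient w Ws A x \<in> vspan n U) \<le> 1 - 3 * \<gamma> / 8"
proof -
  have A: "A \<in> carrier_mat k n" using shape by (simp add: network_shape_iff)
  let ?G = "std_gaussian {..<n}" and ?\<zeta> = "local_gradient w Ws A"
  interpret G: prob_space ?G by (rule prob_space_std_gaussian)
  define R where "R = {support c |c. c \<in> carrier_vec k \<and> A\<^sup>T *\<^sub>v c \<in> vspan n U}"
  define F where "F = Pow {..<k} - R"
  have "card R \<le> 2 ^ (k - 1)" unfolding R_def by (rule card_supports_le[OF A rank U])
  moreover have "R \<subseteq> Pow {..<k}" by (auto simp: R_def support_def)
  ultimately have "2 ^ k - 2 ^ (k - 1) \<le> card F"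
    unfolding F_def by (subst card_Diff_subset) (auto intro: finite_subset simp: card_Pow)
  moreover have "(2::nat) ^ k = 2 * 2 ^ (k - 1)" using k by (metis Suc_pred' power_Suc)
  ultimately have F: "2 ^ (k - 1) \<le> card F" by simp
  have "\<gamma> / 2 = real (2 ^ (k - 1)) * (\<gamma> / 2 ^ k)"
    using \<open>(2::nat) ^ k = 2 * 2 ^ (k - 1)\<close> k by (cases k) simp_all
  also have "\<dots> \<le> real (card F) * (\<gamma> / 2 ^ k)"
    using F \<gamma> by (intro mult_right_mono of_nat_mono) auto
  also have "\<dots> \<le> gauss_prob n (\<lambda>x. pos (A *\<^sub>v x) \<in> F)"
    by (rule gauss_prob_pos_mem_ge[OF A a1]) (simp add: F_def)
  finally have lower: "\<gamma> / 2 \<le> gauss_prob n (\<lambda>x. pos (A *\<^sub>v x) \<in> F)" .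
  let ?S = "{g \<in> space ?G. ?\<zeta> (Matrix.vec n g) \<in> vspan n U}"
  let ?N = "{g \<in> space ?G. network w Ws A (Matrix.vec n g) = 0}"
  have S: "?S \<in> sets ?G"
    using pred_simple_function[OF simple_function_local_gradient[OF shape measurable_vec_std_gaussian],
        of "\<lambda>z. z \<in> vspan n U"] by (simp only: pred_def)
  have N: "?N \<in> sets ?G"
    using measurable_network[OF shape measurable_vec_std_gaussian] by measurable
  \<comment> \<open>A pattern outside \<open>R\<close> with a non-zero network value forces the
    gradient out of the span, since otherwise its coefficient vector would put the pattern into
    \<open>R\<close>.\<close>
  have "{g \<in> space ?G. pos (A *\<^sub>v Matrix.vec n g) \<in> F} \<subseteq> (space ?G - ?S) \<union> ?N"
  proof (rule subsetI, rule ccontr)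
    fix g assume "g \<in> {g \<in> space ?G. pos (A *\<^sub>v Matrix.vec n g) \<in> F}" "g \<notin> (space ?G - ?S) \<union> ?N"
    then have g: "g \<in> space ?G" "pos (A *\<^sub>v Matrix.vec n g) \<in> F" "network w Ws A (Matrix.vec n g) \<noteq> 0"
      and mem: "?\<zeta> (Matrix.vec n g) \<in> vspan n U" by blast+
    let ?c = "coefficients w Ws A (Matrix.vec n g)"
    have "?c \<in> carrier_vec k" using A by (intro carrier_vecI) (simp add: coefficients_def)
    moreover have "support ?c = pos (A *\<^sub>v Matrix.vec n g)"
      by (rule support_coefficients[OF shape a2 _ g(3)]) simp
    ultimately have "pos (A *\<^sub>v Matrix.vec n g) \<in> R"
      using mem unfolding R_def local_gradient_eq_coefficients[OF shape] by blast
    then show False using g(2) by (simp add: F_def)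
  qed
  then have "gauss_prob n (\<lambda>x. pos (A *\<^sub>v x) \<in> F) \<le> measure ?G ((space ?G - ?S) \<union> ?N)"
    unfolding gauss_prob_def using S N by (intro G.finite_measure_mono) auto
  also have "\<dots> \<le> measure ?G (space ?G - ?S) + measure ?G ?N"
    using S N by (intro measure_Un_le) auto
  also have "measure ?G (space ?G - ?S) = 1 - measure ?G ?S" by (rule G.prob_compl[OF S])
  also have "measure ?G ?N \<le> \<gamma> / 8" using a2 by (simp add: assumption2_def gauss_prob_def)
  finally show ?thesis using lower by (simp add: gauss_prob_def)
qed

text \<open>Outside the two bad events \<open>?B\<close> and \<open>?F\<close> success is
  deterministic: the quotients are the local gradients, these lie in the row space because they are
  \<open>A\<^sup>T\<close> times a vector, and enough of them are independent.\<close>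

lemma prob_success_ge:
  fixes \<gamma> \<epsilon> :: real and gzs :: "(nat \<Rightarrow> real) \<Rightarrow> (real list \<times> real list) list"
  assumes shape: "network_shape n k ks w Ws A" and rank: "vec_space.rank k A = k"
    and a1: "assumption1 n k \<gamma> A" and a2: "assumption2 n k ks \<gamma> w Ws A"
    and pos: "0 < \<gamma>" "0 < k" "0 < \<epsilon>"
    and gzs: "\<And>\<omega>. map (map_prod vec_of_list vec_of_list) (gzs \<omega>) =
      map (\<lambda>i. (block n i \<omega>, quotients \<epsilon> n (network w Ws A) (block n i \<omega>))) [0..<r]"
  shows "measure (std_gaussian UNIV) {\<omega> \<in> space (std_gaussian UNIV). success n k A (network w Ws A) (gzs \<omega>)}
    \<ge> 1 - real r * real (num_preactivations ks k) * (2 * \<epsilon>)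
        - 2 ^ ((k + 1) div 2 - 1) * (1 - \<gamma> / 8) ^ r"
proof -
  have A: "A \<in> carrier_mat k n" and L: "layers ks k Ws" using shape by (simp_all add: network_shape_iff)
  let ?P = "std_gaussian UNIV" and ?\<zeta> = "local_gradient w Ws A" and ?m = "(k + 1) div 2"
  interpret P: prob_space ?P by (rule prob_space_std_gaussian)
  note \<gamma>1 = gamma_le_1[OF A a1]
  let ?S = "{\<omega> \<in> space ?P. success n k A (network w Ws A) (gzs \<omega>)}"
  have S: "?S \<in> sets ?P"
    using measurable_success[OF shape rank measurable_vec_block gzs] by (simp only: pred_def)
  let ?B = "{\<omega> \<in> space ?P. \<exists>i<r. \<not> clear_of n \<epsilon> (preactivations Ws A) (block n i \<omega>)}"
  have pre: "finite (preactivations Ws A)" "card (preactivations Ws A) \<le> num_preactivations ks k"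
    "preactivations Ws A \<subseteq> carrier_vec n"
    using preactivations_finite_card[OF L A] preactivations_carrier[OF L A] by simp_all
  note B = prob_not_clear_le[OF pre(1,3,2) pos(3)]
  have sf: "simple_function ?P (\<lambda>\<omega>. ?\<zeta> (block n i \<omega>))" for i
    by (rule simple_function_local_gradient[OF shape measurable_vec_block])
  define few where "few Z \<longleftrightarrow> \<not> (\<exists>T\<subseteq>{} \<union> Z. vindep n T \<and> card T = ?m)" for Z
  let ?F = "{\<omega> \<in> space ?P. few ((\<lambda>i. ?\<zeta> (block n i \<omega>)) ` {..<r})}"
  have F: "?F \<in> sets ?P"
  proof -
    have "simple_function ?P (\<lambda>\<omega>. map (\<lambda>i. ?\<zeta> (block n i \<omega>)) [0..<r])"
      by (rule simple_function_map[OF sf])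
    then have "Measurable.pred ?P (\<lambda>\<omega>. few (set (map (\<lambda>i. ?\<zeta> (block n i \<omega>)) [0..<r])))"
      by (rule pred_simple_function)
    then show ?thesis by (simp add: lessThan_atLeast0 pred_def)
  qed
  \<comment> \<open>\<open>p = \<gamma> / 4\<close> is weaker than the available
    \<open>3 * \<gamma> / 8\<close> and turns the rate \<open>1 - p / 2\<close> into
    \<open>1 - \<gamma> / 8\<close>. The start is the empty set with all \<open>?m\<close>
    dimensions missing.\<close>
  have "emeasure ?P ?F \<le> ennreal (2 ^ (?m - 1) * (1 - \<gamma> / 4 / 2) ^ r)"
    unfolding few_def
  proof (rule prob_few_independent_le[OF local_gradient_carrier[OF shape] sf])
    fix U :: "real Matrix.vec set" assume U: "finite U" "U \<subseteq> carrier_vec n" "card U < ?m"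
    have "measure ?P {\<omega> \<in> space ?P. ?\<zeta> (block n 0 \<omega>) \<in> vspan n U} =
        gauss_prob n (\<lambda>x. ?\<zeta> x \<in> vspan n U)"
      by (intro measure_block_eq_gauss_prob pred_simple_function
          simple_function_local_gradient[OF shape measurable_vec_std_gaussian])
    \<comment> \<open>\<open>card U < (k + 1) div 2\<close> amounts to
      \<open>2 * card U < k\<close>.\<close>
    also have "\<dots> \<le> 1 - 3 * \<gamma> / 8"
      using U by (intro gauss_prob_gradient_in_span_le[OF shape rank a1 a2 pos(1,2)]) auto
    finally show "measure ?P {\<omega> \<in> space ?P. ?\<zeta> (block n 0 \<omega>) \<in> vspan n U} \<le> 1 - \<gamma> / 4"
      using pos by simp
  next
    interpret vec_space "TYPE(real)" n .
    show "vindep n {}" using finite_lin_indpt2[of "{}"] by simp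
  qed (use pos \<gamma>1 in auto)
  then have F': "measure ?P ?F \<le> 2 ^ (?m - 1) * (1 - \<gamma> / 8) ^ r"
    using \<gamma>1 by (simp add: P.emeasure_eq_measure)
  have "space ?P - ?S \<subseteq> ?B \<union> ?F"
  proof
    fix \<omega> assume w: "\<omega> \<in> space ?P - ?S"
    show "\<omega> \<in> ?B \<union> ?F"
    proof (rule ccontr)
      assume "\<omega> \<notin> ?B \<union> ?F"
      then have clear: "\<And>i. i < r \<Longrightarrow> clear_of n \<epsilon> (preactivations Ws A) (block n i \<omega>)"
        and many: "\<not> few ((\<lambda>i. ?\<zeta> (block n i \<omega>)) ` {..<r})" using w by auto
      have bc: "block n i \<omega> \<in> carrier_vec n" for i by (simp add: block_def)
      have z: "quotients \<epsilon> n (network w Ws A) (block n i \<omega>) = ?\<zeta> (block n i \<omega>)" if "i < r" for i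
        by (rule quotients_eq_local_gradient[OF shape bc pos(3) clear[OF that]])
      have "map (map_prod vec_of_list vec_of_list) (gzs \<omega>) =
          map (\<lambda>i. (block n i \<omega>, ?\<zeta> (block n i \<omega>))) [0..<r]"
        unfolding gzs using z by simp
      note iff = success_iff[OF this local_gradient_carrier[OF shape] A, of "network w Ws A"]
      have "?\<zeta> x \<in> vec_space.row_space n A" for x
      proof -
        interpret vec_space "TYPE(real)" n .
        have "coefficients w Ws A x \<in> carrier_vec k" using A by (intro carrier_vecI) (simp add: coefficients_def)
        then have "\<exists>y\<in>carrier_vec k. A\<^sup>T *\<^sub>v y = ?\<zeta> x"
          using local_gradient_eq_coefficients[OF shape] by metis
        then show ?thesis using row_space_eq[OF A] A local_gradient_carrier[OF shape] by simp
      qed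
      moreover have "is_gradient n (network w Ws A) (block n i \<omega>) (?\<zeta> (block n i \<omega>))" if "i < r" for i
        by (rule is_gradient_local_gradient[OF shape bc pos(3) clear[OF that]])
      moreover have "?m \<le> vec_space.rank n (mat_of_cols n (map (\<lambda>i. ?\<zeta> (block n i \<omega>)) [0..<r]))"
      proof -
        have "set (map (\<lambda>i. ?\<zeta> (block n i \<omega>)) [0..<r]) \<subseteq> carrier_vec n"
          using local_gradient_carrier[OF shape] by auto
        then show ?thesis
          using many unfolding few_def by (subst rank_ge_iff) (simp_all add: lessThan_atLeast0)
      qed
      ultimately have "success n k A (network w Ws A) (gzs \<omega>)" unfolding iff by simp
      then show False using w by simp
    qed
  qed
  then have "measure ?P (space ?P - ?S) \<le> measure ?P (?B \<union> ?F)"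
    by (rule P.finite_measure_mono[OF _ sets.Un[OF B(1) F]])
  also have "\<dots> \<le> measure ?P ?B + measure ?P ?F"
    by (rule measure_Un_le[OF B(1) F])
  finally show ?thesis
    using B(2)[of r] F' P.prob_compl[OF S] by linarith
qed

section \<open>Numerical bounds on rounds, failure, queries and time\<close>

lemma rounds_bounds:
  assumes "0 < k" "0 < \<gamma>" "0 < \<delta>" "\<delta> < 1" "0 < c"
  shows "c * (real k * ln (real k / \<delta>)) / \<gamma> \<le> real (rounds c k \<gamma> \<delta>)"
    "real (rounds c k \<gamma> \<delta>) \<le> c * (real k * ln (real k / \<delta>)) / \<gamma> + 1"
proof -
  \<comment> \<open>\<open>k / \<delta> \<ge> 1\<close> makes the logarithm non-negative, so
    \<open>nat\<close> does not truncate.\<close>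
  have "\<delta> \<le> real k" using assms by (cases k) auto
  then have "0 \<le> ln (real k / \<delta>)" using assms by (intro ln_ge_zero) simp
  then have "0 \<le> c * (real k * ln (real k / \<delta>)) / \<gamma>" using assms by simp
  then show "c * (real k * ln (real k / \<delta>)) / \<gamma> \<le> real (rounds c k \<gamma> \<delta>)"
    "real (rounds c k \<gamma> \<delta>) \<le> c * (real k * ln (real k / \<delta>)) / \<gamma> + 1"
    unfolding rounds_def by linarith+
qed

text \<open>The constant 16 gives
  \<open>(1 - \<gamma> / 8) ^ r \<le> (\<delta> / k) ^ (2 * k)\<close>; a factor
  \<open>k ^ k\<close> of the denominator absorbs the power of 2. Aiming at
  \<open>\<delta>\<^sup>2\<close> instead of \<delta> leaves
  \<open>\<delta> - \<delta>\<^sup>2\<close> for the finite differences.\<close>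

lemma failure_bound:
  assumes k: "0 < k" and \<gamma>: "0 < \<gamma>" "\<gamma> \<le> 1" and \<delta>: "0 < \<delta>" "\<delta> < 1"
  shows "2 ^ ((k + 1) div 2 - 1) * (1 - \<gamma> / 8) ^ rounds 16 k \<gamma> \<delta> \<le> \<delta>\<^sup>2"
proof -
  let ?r = "rounds 16 k \<gamma> \<delta>"
  have k1: "1 \<le> real k" using k by simp
  have lnk: "0 \<le> ln (real k)" using k1 by (rule ln_ge_zero)
  have ln\<delta>: "ln \<delta> \<le> 0" using \<delta> by simp
  have "(2::real) ^ ((k + 1) div 2 - 1) \<le> real k ^ k"
  \<comment> \<open>For \<open>k = 1\<close> the right-hand side is 1 and absorbs nothing; there the
    exponent \<open>(k + 1) div 2 - 1\<close> is 0.\<close>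
  proof (cases "k = 1")
    case False
    then have "2 \<le> real k" using k by simp
    have "(2::real) ^ ((k + 1) div 2 - 1) \<le> 2 ^ k" by (intro power_increasing) auto
    also have "\<dots> \<le> real k ^ k" using \<open>2 \<le> real k\<close> by (intro power_mono) auto
    finally show ?thesis .
  qed simp
  also have "real k ^ k = exp (real k * ln (real k))"
    using k by (simp add: exp_of_nat_mult)
  finally have 1: "(2::real) ^ ((k + 1) div 2 - 1) \<le> exp (real k * ln (real k))" .
  have "1 - \<gamma> / 8 \<le> exp (- \<gamma> / 8)" using exp_ge_add_one_self[of "- \<gamma> / 8"] by simp
  then have "(1 - \<gamma> / 8) ^ ?r \<le> exp (- \<gamma> / 8) ^ ?r" using \<gamma> by (intro power_mono) auto
  also have "\<dots> = exp (- (\<gamma> * real ?r / 8))" by (simp add: exp_of_nat_mult[symmetric] algebra_simps)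
  also have "\<dots> \<le> exp (- (2 * (real k * ln (real k / \<delta>))))"
  proof -
    have "16 * (real k * ln (real k / \<delta>)) / \<gamma> \<le> real ?r"
      using rounds_bounds(1)[OF k \<gamma>(1) \<delta>, of 16] by simp
    then have "16 * (real k * ln (real k / \<delta>)) \<le> \<gamma> * real ?r"
      using \<gamma> by (simp add: pos_divide_le_eq mult.commute)
    then show ?thesis by simp
  qed
  finally have 2: "(1 - \<gamma> / 8) ^ ?r \<le> exp (- (2 * (real k * ln (real k / \<delta>))))" .
  have "2 ^ ((k + 1) div 2 - 1) * (1 - \<gamma> / 8) ^ ?r \<le>
      exp (real k * ln (real k)) * exp (- (2 * (real k * ln (real k / \<delta>))))"
    using 1 2 \<gamma> by (intro mult_mono) auto
  also have "\<dots> = exp (real k * (2 * ln \<delta> - ln (real k)))"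
    using k \<delta> by (simp add: exp_add[symmetric] ln_div algebra_simps)
  also have "\<dots> \<le> exp (2 * ln \<delta>)"
  proof -
    \<comment> \<open>The second factor is non-positive, so lowering \<open>k\<close> to 1 increases
      the product.\<close>
    have "real k * (2 * ln \<delta> - ln (real k)) \<le> 1 * (2 * ln \<delta> - ln (real k))"
      using k1 lnk ln\<delta> by (intro mult_right_mono_neg) linarith+
    also have "\<dots> \<le> 2 * ln \<delta>" using lnk by simp
    finally show ?thesis by simp
  qed
  also have "\<dots> = \<delta>\<^sup>2" using \<delta> by (simp add: exp_double)
  finally show ?thesis .
qed

text \<open>The ceiling costs up to one extra round, which \<open>k * m / \<gamma> \<ge> 1\<close>
  absorbs thanks to \<open>\<gamma> \<le> 1\<close> and the maximum with 1; moreover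
  \<open>n + 1 \<le> 2 * n\<close>. The constant 500 is shared with the running time.\<close>

lemma query_bound:
  assumes k: "0 < k" "k < n" and \<gamma>: "0 < \<gamma>" "\<gamma> \<le> 1" and \<delta>: "0 < \<delta>" "\<delta> < 1"
  shows "real (rounds 16 k \<gamma> \<delta> * (n + 1)) \<le> 500 * (real k * real n * max 1 (ln (real k / \<delta>)) / \<gamma>)"
proof -
  define m where "m = max 1 (ln (real k / \<delta>))"
  have m: "1 \<le> m" "ln (real k / \<delta>) \<le> m" by (simp_all add: m_def)
  have km: "1 \<le> real k * m" using k m mult_mono[of 1 "real k" 1 m] by simp
  have "real (rounds 16 k \<gamma> \<delta>) \<le> 16 * (real k * ln (real k / \<delta>)) / \<gamma> + 1"
    by (rule rounds_bounds(2)) (use assms in auto)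
  also have "\<dots> \<le> 16 * (real k * m) / \<gamma> + real k * m / \<gamma>"
  proof (rule add_mono)
    show "16 * (real k * ln (real k / \<delta>)) / \<gamma> \<le> 16 * (real k * m) / \<gamma>"
      using m k \<gamma> by (intro divide_right_mono mult_left_mono) auto
    show "1 \<le> real k * m / \<gamma>" using km \<gamma> by (simp add: pos_le_divide_eq)
  qed
  finally have "real (rounds 16 k \<gamma> \<delta>) \<le> 17 * (real k * m / \<gamma>)" by (simp add: mult.commute)
  then have "real (rounds 16 k \<gamma> \<delta>) * real (n + 1) \<le> 17 * (real k * m / \<gamma>) * (2 * real n)"
    using k \<gamma> m by (intro mult_mono) auto
  also have "\<dots> = 34 * (real k * real n * m / \<gamma>)" by simp
  also have "\<dots> \<le> 500 * (real k * real n * m / \<gamma>)"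
    using m \<gamma> by (intro mult_right_mono) auto
  finally show ?thesis unfolding m_def of_nat_mult .
qed

text \<open>Everything is compared with the sum \<open>X\<close>: at most \<open>17 * X ^ 3\<close>
  rounds, with one factor each for \<open>k\<close>, the logarithm and \<open>1 / \<gamma>\<close>,
  of cost at most \<open>26 * X\<^sup>2\<close>. This gives \<open>442 * X ^ 5\<close>, plus 13 for
  the fixed costs.\<close>

lemma run_time_bound:
  assumes k: "0 < k" "k < n" and \<gamma>: "0 < \<gamma>" and \<delta>: "0 < \<delta>" "\<delta> < 1"
  shows "real (rounds 16 k \<gamma> \<delta> * (2 * n * n + 16 * n + 8) + 13)
    \<le> 500 * (real n + real k + 1 / \<gamma> + ln (1 / \<delta>)) ^ 5"
proof -
  define X where "X = real n + real k + 1 / \<gamma> + ln (1 / \<delta>)"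
  have ln\<delta>: "0 \<le> ln (1 / \<delta>)" using \<delta> by simp
  have X: "1 \<le> X" "real n \<le> X" "real k \<le> X" "1 / \<gamma> \<le> X"
  proof -
    have "1 \<le> real n" "0 < 1 / \<gamma>" using k \<gamma> by simp_all
    then show "1 \<le> X" "real n \<le> X" "real k \<le> X" "1 / \<gamma> \<le> X"
      using ln\<delta> unfolding X_def by linarith+
  qed
  have "ln (real k / \<delta>) = ln (real k) + ln (1 / \<delta>)" using k \<delta> by (simp add: ln_div)
  moreover have "0 \<le> ln (real k)" "ln (real k) \<le> real k" "0 < 1 / \<gamma>"
    using ln_bound[of "real k"] k \<gamma> by simp_all
  ultimately have l: "ln (real k / \<delta>) \<le> X" "0 \<le> ln (real k / \<delta>)"
    using ln\<delta> unfolding X_def by linarith+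
  have "real k * ln (real k / \<delta>) \<le> X * X"
    using X l by (intro mult_mono) auto
  then have "real k * ln (real k / \<delta>) * (1 / \<gamma>) \<le> X * X * X"
    by (rule mult_mono) (use X \<gamma> in auto)
  then have "16 * (real k * ln (real k / \<delta>)) / \<gamma> \<le> 16 * X ^ 3" by (simp add: power3_eq_cube)
  moreover have "1 \<le> X ^ 3" using X by (simp add: one_le_power)
  ultimately have r: "real (rounds 16 k \<gamma> \<delta>) \<le> 17 * X ^ 3"
    using rounds_bounds(2)[of k \<gamma> \<delta> 16] assms by simp
  have "1 \<le> real n" using k by simp
  then have "real n \<le> real n * real n" "1 \<le> real n * real n"
    using mult_mono[of 1 "real n" 1 "real n"] by auto
  moreover have "real n * real n \<le> X * X" using X by (intro mult_mono) auto
  ultimately have "2 * (real n * real n) + 16 * real n + 8 \<le> 26 * (X * X)" by linarith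
  then have "real (rounds 16 k \<gamma> \<delta>) * (2 * (real n * real n) + 16 * real n + 8) \<le> 17 * X ^ 3 * (26 * (X * X))"
    using r X by (intro mult_mono) auto
  also have "\<dots> = 442 * X ^ 5" by (simp add: eval_nat_numeral)
  finally have "real (rounds 16 k \<gamma> \<delta>) * (2 * (real n * real n) + 16 * real n + 8) \<le> 442 * X ^ 5" .
  moreover have "1 \<le> X ^ 5" using X by (simp add: one_le_power)
  ultimately show ?thesis unfolding X_def[symmetric] by (simp add: algebra_simps)
qed

theorem theorem1:
  shows "\<exists>c > 0. \<exists>C > 0. \<exists>D :: nat.
    \<forall>(n :: nat) (k :: nat) (ks :: nat list) (\<gamma> :: real) (\<delta> :: real).
      0 < k \<and> k < n \<and> 0 < \<gamma> \<and> 0 < \<delta> \<and> \<delta> < 1 \<longrightarrow>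
      (\<exists>\<epsilon>0 > 0. \<forall>\<epsilon>. 0 < \<epsilon> \<and> \<epsilon> \<le> \<epsilon>0 \<longrightarrow>
        (\<forall>w Ws A.
          network_shape n k ks w Ws A \<and> vec_space.rank k A = k \<and>
          assumption1 n k \<gamma> A \<and> assumption2 n k ks \<gamma> w Ws A \<longrightarrow>
          (let M = network w Ws A; alg = span_recovery c \<epsilon> n k \<gamma> \<delta> in
             (\<forall>\<omega>. real (queries alg M \<omega>) \<le> C * (real k * real n * max 1 (ln (real k / \<delta>)) / \<gamma>)) \<and>
             (\<forall>\<omega>. real (run_time alg M \<omega>)
                    \<le> C * (real n + real k + 1 / \<gamma> + ln (1 / \<delta>)) ^ D) \<and>
             measure (std_gaussian UNIV)
               {\<omega> \<in> space (std_gaussian UNIV). success n k A M (outcome alg M \<omega>)} \<ge> 1 - \<delta>)))"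
proof -
  have main: "\<exists>\<epsilon>0 > 0. \<forall>\<epsilon>. 0 < \<epsilon> \<and> \<epsilon> \<le> \<epsilon>0 \<longrightarrow>
        (\<forall>w Ws A.
          network_shape n k ks w Ws A \<and> vec_space.rank k A = k \<and>
          assumption1 n k \<gamma> A \<and> assumption2 n k ks \<gamma> w Ws A \<longrightarrow>
          (let M = network w Ws A; alg = span_recovery 16 \<epsilon> n k \<gamma> \<delta> in
             (\<forall>\<omega>. real (queries alg M \<omega>) \<le> 500 * (real k * real n * max 1 (ln (real k / \<delta>)) / \<gamma>)) \<and>
             (\<forall>\<omega>. real (run_time alg M \<omega>)
                    \<le> 500 * (real n + real k + 1 / \<gamma> + ln (1 / \<delta>)) ^ 5) \<and>
             measure (std_gaussian UNIV)
               {\<omega> \<in> space (std_gaussian UNIV). success n k A M (outcome alg M \<omega>)} \<ge> 1 - \<delta>))"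
    if k: "0 < k" "k < n" and \<gamma>: "0 < \<gamma>" and \<delta>: "0 < \<delta>" "\<delta> < 1"
    for n k :: nat and ks :: "nat list" and \<gamma> \<delta> :: real
  proof -
    \<comment> \<open>\<open>K * \<epsilon>\<close> bounds the probability that some sample point is
      too close to a hyperplane; the \<open>+ 1\<close> in the next definition keeps the denominator
      positive. Both quantities are fixed before the weights.\<close>
    define K where "K = real (rounds 16 k \<gamma> \<delta>) * real (num_preactivations ks k) * 2"
    define \<epsilon>0 where "\<epsilon>0 = (\<delta> - \<delta>\<^sup>2) / (K + 1)"
    have K: "0 \<le> K" by (simp add: K_def)
    have slack: "0 < \<delta> - \<delta>\<^sup>2" using \<delta> by (simp add: power2_eq_square)
    have "0 < \<epsilon>0" using K slack by (simp add: \<epsilon>0_def)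
    show ?thesis
    proof (intro exI[of _ \<epsilon>0] conjI \<open>0 < \<epsilon>0\<close> allI impI)
      fix \<epsilon> w Ws A
      assume \<epsilon>: "0 < \<epsilon> \<and> \<epsilon> \<le> \<epsilon>0"
        and asm: "network_shape n k ks w Ws A \<and> vec_space.rank k A = k \<and>
          assumption1 n k \<gamma> A \<and> assumption2 n k ks \<gamma> w Ws A"
      let ?M = "network w Ws A" and ?alg = "span_recovery 16 \<epsilon> n k \<gamma> \<delta>"
      have \<gamma>1: "\<gamma> \<le> 1" using gamma_le_1 asm by (auto simp: network_shape_iff)
      have "real (queries ?alg ?M \<omega>) \<le> 500 * (real k * real n * max 1 (ln (real k / \<delta>)) / \<gamma>)" for \<omega>
        unfolding span_recovery_simps(1) by (rule query_bound[OF k \<gamma> \<gamma>1 \<delta>])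
      moreover have "real (run_time ?alg ?M \<omega>) \<le> 500 * (real n + real k + 1 / \<gamma> + ln (1 / \<delta>)) ^ 5" for \<omega>
        by (rule order.trans[OF of_nat_mono[OF span_recovery_simps(2)] run_time_bound[OF k \<gamma> \<delta>]])
      moreover have "measure (std_gaussian UNIV)
          {\<omega> \<in> space (std_gaussian UNIV). success n k A ?M (outcome ?alg ?M \<omega>)} \<ge> 1 - \<delta>"
      proof -
        have "K * \<epsilon> \<le> (K + 1) * \<epsilon>0" using K \<epsilon> by (intro mult_mono) auto
        also have "\<dots> = \<delta> - \<delta>\<^sup>2" using K by (simp add: \<epsilon>0_def)
        finally have "real (rounds 16 k \<gamma> \<delta>) * real (num_preactivations ks k) * (2 * \<epsilon>) \<le> \<delta> - \<delta>\<^sup>2"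
          by (simp add: K_def mult.assoc)
        moreover have "2 ^ ((k + 1) div 2 - 1) * (1 - \<gamma> / 8) ^ rounds 16 k \<gamma> \<delta> \<le> \<delta>\<^sup>2"
          by (rule failure_bound[OF k(1) \<gamma> \<gamma>1 \<delta>])
        moreover have "measure (std_gaussian UNIV)
            {\<omega> \<in> space (std_gaussian UNIV). success n k A ?M (outcome ?alg ?M \<omega>)}
          \<ge> 1 - real (rounds 16 k \<gamma> \<delta>) * real (num_preactivations ks k) * (2 * \<epsilon>)
            - 2 ^ ((k + 1) div 2 - 1) * (1 - \<gamma> / 8) ^ rounds 16 k \<gamma> \<delta>"
          using asm \<epsilon> \<gamma> k by (intro prob_success_ge span_recovery_simps(3)) auto
        ultimately show ?thesis by linarith
      qed
      ultimately show "let M = ?M; alg = ?alg in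
             (\<forall>\<omega>. real (queries alg M \<omega>) \<le> 500 * (real k * real n * max 1 (ln (real k / \<delta>)) / \<gamma>)) \<and>
             (\<forall>\<omega>. real (run_time alg M \<omega>)
                    \<le> 500 * (real n + real k + 1 / \<gamma> + ln (1 / \<delta>)) ^ 5) \<and>
             measure (std_gaussian UNIV)
               {\<omega> \<in> space (std_gaussian UNIV). success n k A M (outcome alg M \<omega>)} \<ge> 1 - \<delta>"
        unfolding Let_def by blast
    qed
  qed
  show ?thesis
    by (rule exI[of _ 16], rule conjI, simp, rule exI[of _ 500], rule conjI, simp, rule exI[of _ 5])
      (use main in blast)
qed

end
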